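(* Let $0<\alpha<1$, $\beta>0$, $y(x)=x^\beta$, and let $t>0$ be fixed. For integers $n\ge2$ let $h=t/n$ and $y_k=y(kh)$. Then, as $n\to\infty$ (with $nh=t$), $$\frac{2^\alpha}{\Gamma(1-\alpha)h^\alpha}\left(\sum_{k=1}^{n-1}\left(\frac{1}{(2k+1)^{\alpha}}-\frac{1}{(2k-1)^{\alpha}} \right)y_{n-k}+y_n\right)=y_n^{(\alpha)}+\frac{2^\alpha-1}{\Gamma(1-\alpha)}\zeta(\alpha)y'_n h^{1-\alpha}+\frac{\zeta(-\beta)}{\Gamma(-\alpha)t^{1+\alpha}}h^{1+\beta}+O\left(h^{2-\alpha}\right).$$
   Context: $\zeta$ is the Riemann zeta function (analytically continued). $y_n=y(t)$, $y'_n=y'(t)=\beta t^{\beta-1}$, and $y_n^{(\alpha)}=y^{(\alpha)}(t)$ is the Caputo derivative $y^{(\alpha)}(t)=\frac{1}{\Gamma(1-\alpha)}\int_0^t \frac{y'(x)}{(t-x)^\alpha}\,dx$, which for $y(x)=x^\beta$ equals $\frac{\Gamma(1+\beta)}{\Gamma(1+\beta-\alpha)}t^{\beta-\alpha}$. *)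

theory Defs
  imports "HOL-Complex_Analysis.Complex_Analysis" "HOL-Library.Landau_Symbols"
begin

definition is_zeta_continuation :: "(complex \<Rightarrow> complex) \<Rightarrow> bool" where
  "is_zeta_continuation f \<longleftrightarrow>
     f holomorphic_on (- {1}) \<and>
     (\<forall>s. Re s > 1 \<longrightarrow> (\<lambda>n. 1 / of_nat (Suc n) powr s) sums f s)"

text \<open>
  Two such functions can differ only at the pole \<open>s = 1\<close> (see the next lemma), so the choice
  only affects the meaningless value \<open>riemann_zeta 1\<close>.
\<close>
definition riemann_zeta :: "complex \<Rightarrow> complex" where
  "riemann_zeta = (SOME f. is_zeta_continuation f)"

lemma is_zeta_continuation_unique:
  assumes f: "is_zeta_continuation f" and g: "is_zeta_continuation g" and "s \<noteq> 1"
  shows   "f s = g s"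
proof (rule analytic_continuation_open[where f = f and g = g and s = "{s. Re s > 1}" and s' = "- {1}"])
  show "open {s. Re s > 1}" by (simp add: open_halfspace_Re_gt)
  show "connected (- {1::complex})" by (rule connected_punctured_universe) simp
  show "{s. Re s > 1} \<noteq> {}" by (auto intro!: exI[of _ "2::complex"])
  show "f z = g z" if "z \<in> {s. Re s > 1}" for z
    using f g that unfolding is_zeta_continuation_def by (auto intro: sums_unique2)
qed (use assms in \<open>auto simp: is_zeta_continuation_def\<close>)

definition caputo_deriv :: "real \<Rightarrow> (real \<Rightarrow> real) \<Rightarrow> real \<Rightarrow> real" where
  "caputo_deriv \<alpha> y t =
     1 / Gamma (1 - \<alpha>) * integral {0..t} (\<lambda>x. deriv y x / (t - x) powr \<alpha>)"

end

theory Submission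
  imports Defs "HOL-Real_Asymp.Real_Asymp"
begin

text \<open>
  Summation by parts turns the left-hand side into the midpoint-type sum
  \<open>\<Sum> (k + 1/2)\<^sup>-\<^sup>\<alpha> \<integral> y'(t - s) ds\<close> over the cells \<open>[k, k + 1]\<close> (in units of \<open>h\<close>), to be compared with
  \<open>\<integral> s\<^sup>-\<^sup>\<alpha> y'(t - s) ds\<close>. In the half of the interval near \<open>s = 0\<close> the factor \<open>y'\<close> is smooth, and the
  midpoint errors of \<open>s\<^sup>-\<^sup>\<alpha>\<close> add up to \<open>(2\<^sup>\<alpha> - 1) \<zeta>(\<alpha>)\<close>; in the half near \<open>s = t\<close> the weight is smooth, and
  its linear part at the cell midpoints produces the trapezoidal errors of \<open>x\<^sup>\<beta>\<close>, which add up to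
  \<open>-\<zeta>(-\<beta>)\<close> if \<open>\<beta> < 1\<close>. If \<open>\<beta> > 1 - \<alpha>\<close>, the term in \<open>h\<^sup>1\<^sup>+\<^sup>\<beta>\<close> is absorbed by the remainder, so that
  \<open>\<zeta>\<close> is only evaluated in the strip where one correction term of the Euler--Maclaurin formula suffices.
\<close>

subsection \<open>Analytic continuation of the zeta function\<close>

text \<open>Measured in units of h = t/n, the sum must be known up to O(n^(\<beta> - 2)); the common
  factor h^(\<beta> - \<alpha>) turns this into O(h^(2 - \<alpha>)). No single expansion serves the
  whole interval, since the weight is singular at s = 0 and y'(t - s) in general at s = t. Cutting
  near the middle leaves in each half one factor whose argument stays in [n/4, n], so its
  derivatives are bounded by powers of n with one constant for all cells, while the singular factor
  is only integrated. Near s = 0 it suffices to freeze the smooth factor at the cell midpoint,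
  because the remaining errors carry the summable factor (k+1)^(-1-\<alpha>). Near s = t there is no
  such decay, and the weight needs its linear term; the derivative of (n - x)^(-\<alpha>) supplies
  the \<alpha> that makes Gamma(-\<alpha>) out of Gamma(1 - \<alpha>). Since
  \<open>riemann_zeta\<close> is a \<open>SOME\<close> choice, nothing is known about its values
  until a continuation has been constructed.\<close>

text \<open>The step is 1, so its powers disappear from the remainder. The condition
  \<open>Re c \<le> Suc K\<close> makes the modulus of the next derivative decreasing along the
  segment, so its value at \<open>a\<close> bounds it; the factorial is dropped.\<close>

lemma powr_taylor_bound:
  fixes a :: real and c :: complex
  assumes a: "a \<ge> 1" and c: "Re c \<le> Suc K"
  shows "norm (of_real (a + 1) powr c -
           (\<Sum>i\<le>K. (\<Prod>l<i. c - of_nat l) * of_real a powr (c - of_nat i) / fact i))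
         \<le> norm (\<Prod>l<Suc K. c - of_nat l) * a powr (Re c - Suc K)"
proof -
  define f :: "nat \<Rightarrow> complex \<Rightarrow> complex"
    where "f = (\<lambda>i w. (\<Prod>l<i. c - of_nat l) * w powr (c - of_nat i))"
  define S where "S = closed_segment (complex_of_real a) (of_real (a + 1))"
  define B where "B = norm (\<Prod>l<Suc K. c - of_nat l) * a powr (Re c - Suc K)"
  have S: "\<exists>x\<ge>a. w = of_real x" if "w \<in> S" for w
  proof -
    from that obtain u where u: "0 \<le> u" "w = (1 - u) *\<^sub>R complex_of_real a + u *\<^sub>R complex_of_real (a + 1)"
      unfolding S_def closed_segment_def by blast
    then have "w = complex_of_real (a + u)" by (simp add: scaleR_conv_of_real algebra_simps)
    with u show ?thesis by (intro exI[of _ "a + u"]) auto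
  qed
  have "norm (f 0 (of_real (a + 1)) -
          (\<Sum>i\<le>K. f i (of_real a) * (of_real (a + 1) - of_real a) ^ i / fact i))
        \<le> B * norm (complex_of_real (a + 1) - of_real a) ^ Suc K / fact K"
  proof (rule complex_Taylor[where S = S])
    fix i x assume x: "x \<in> S"
    then obtain r where r: "r \<ge> a" "x = of_real r" using S by blast
    with a have "x \<notin> \<real>\<^sub>\<le>\<^sub>0" by simp
    then show "(f i has_field_derivative f (Suc i) x) (at x within S)"
      unfolding f_def by (auto intro!: derivative_eq_intros simp: algebra_simps)
    have "norm (f (Suc K) x) = norm (\<Prod>l<Suc K. c - of_nat l) * r powr (Re c - Suc K)"
      using r a by (simp add: f_def norm_mult norm_powr_real_powr)
    also have "\<dots> \<le> B"
      unfolding B_def using r a c by (intro mult_left_mono powr_mono2') auto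
    finally show "norm (f (Suc K) x) \<le> B" .
  qed (auto simp: S_def)
  moreover have "B / fact K \<le> B"
  proof -
    have "B \<ge> 0" by (simp add: B_def)
    then have "B * 1 \<le> B * fact K" by (intro mult_left_mono fact_ge_1)
    then show ?thesis by (simp add: field_simps)
  qed
  ultimately show ?thesis by (simp add: f_def B_def)
qed

text \<open>A Weierstrass test for locally uniform convergence: near each point the exponent stays a
  fixed distance beyond 1 and \<open>q\<close> is bounded by compactness.\<close>

lemma holomorphic_sums_powr_bound:
  fixes f :: "nat \<Rightarrow> complex \<Rightarrow> complex"
  assumes S: "open S" and f: "\<And>n. f n holomorphic_on S" and q: "continuous_on S q"
    and bound: "\<And>n s. s \<in> S \<Longrightarrow> norm (f n s) \<le> norm (q s :: complex) * real (Suc n) powr - (Re s + c)"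
    and c: "\<And>s. s \<in> S \<Longrightarrow> Re s + c > 1"
  obtains g where "g holomorphic_on S" "\<And>s. s \<in> S \<Longrightarrow> (\<lambda>n. f n s) sums g s"
proof -
  have to_g: "\<exists>d h. 0 < d \<and> summable h \<and> range h \<subseteq> \<real>\<^sub>\<ge>\<^sub>0 \<and>
          (\<forall>\<^sub>F n in sequentially. \<forall>y\<in>ball x d \<inter> S. norm (f n y) \<le> norm (h n :: complex))"
    if x: "x \<in> S" for x
  proof -
    obtain e where e: "e > 0" "cball x e \<subseteq> S" using S x open_contains_cball by blast
    \<comment> \<open>Half of the margin \<open>Re x + c - 1\<close> is given away, so that the
      exponent still exceeds 1 on the whole ball.\<close>
    define d where "d = min e ((Re x + c - 1) / 2)"
    have d: "d > 0" "d \<le> e" "1 < Re x + c - d" using e c[OF x] by (auto simp: d_def min_def field_simps)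
    have "compact (q ` cball x e)"
      using e q by (intro compact_continuous_image continuous_on_subset[OF q]) auto
    then obtain B where B: "\<And>y. y \<in> cball x e \<Longrightarrow> norm (q y) \<le> B"
      by (meson bounded_iff compact_imp_bounded imageI)
    have B0: "B \<ge> 0" using B[of x] e norm_ge_zero[of "q x"] by (metis centre_in_cball less_imp_le order_trans)
    define h where "h = (\<lambda>n. complex_of_real (B * real (Suc n) powr - (Re x + c - d)))"
    have "summable (\<lambda>n. real (Suc n) powr - (Re x + c - d))"
      using d by (subst summable_Suc_iff, subst summable_real_powr_iff) auto
    then have "summable h"
      unfolding h_def by (intro summable_of_real summable_mult)
    moreover have "h n \<in> \<real>\<^sub>\<ge>\<^sub>0" for n
      unfolding h_def nonneg_Reals_of_real_iff by (rule mult_nonneg_nonneg[OF B0]) (rule powr_ge_zero)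
    then have "range h \<subseteq> \<real>\<^sub>\<ge>\<^sub>0" by (rule image_subsetI)
    moreover have "norm (f n y) \<le> norm (h n)" if y: "y \<in> ball x d \<inter> S" for n y
    proof -
      have "\<bar>Re (x - y)\<bar> < d" using y abs_Re_le_cmod[of "x - y"] by (auto simp: dist_norm)
      then have "Re y + c \<ge> Re x + c - d" by auto
      then have "real (Suc n) powr - (Re y + c) \<le> real (Suc n) powr - (Re x + c - d)"
        by (intro powr_mono) auto
      moreover have "norm (q y) \<le> B" using y d by (intro B) auto
      ultimately have "norm (q y) * real (Suc n) powr - (Re y + c) \<le> B * real (Suc n) powr - (Re x + c - d)"
        using B0 by (intro mult_mono) auto
      moreover have "norm (f n y) \<le> norm (q y) * real (Suc n) powr - (Re y + c)"
        using y by (intro bound) auto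
      moreover have "norm (h n) = B * real (Suc n) powr - (Re x + c - d)"
        unfolding h_def norm_of_real using B0 by simp
      ultimately show ?thesis by linarith
    qed
    ultimately show ?thesis using d(1) by (intro exI[of _ d] exI[of _ h] conjI always_eventually allI ballI)
  qed
  have diff: "f n field_differentiable at x" if "x \<in> S" for n x
    using f S that holomorphic_on_imp_differentiable_at by blast
  obtain g where g: "\<forall>x\<in>S. (\<lambda>n. f n x) sums g x \<and> g field_differentiable (at x)"
    using series_differentiable_comparison_complex[where f = f, OF S diff to_g] by metis
  show ?thesis
  proof
    show "g holomorphic_on S"
      using g by (auto simp: holomorphic_on_def intro: field_differentiable_at_within)
  qed (use g in blast)
qed

text \<open>
  Summing the Taylor expansion of \<open>(n + 1)\<^sup>1\<^sup>-\<^sup>s\<close> about \<open>n\<close> over all \<open>n\<close> expresses \<open>Z(s) = (s - 1) \<zeta>(s)\<close>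
  through \<open>Z(s + 1), \<dots>, Z(s + m)\<close>; working with \<open>Z\<close> instead of \<open>\<zeta>\<close> cancels all poles.
\<close>
lemma zeta_halfplane_continuation:
  "\<exists>Z. Z holomorphic_on {s. Re s > 1 - real m} \<and>
     (\<forall>s. Re s > 1 \<longrightarrow> (\<lambda>n. 1 / of_nat (Suc n) powr s) sums (Z s / (s - 1)))"
proof (induction m)
  case 0
  have "open {s. Re s > 1}" by (rule open_halfspace_Re_gt)
  then obtain g where g: "g holomorphic_on {s. Re s > 1}"
    "\<And>s. Re s > 1 \<Longrightarrow> (\<lambda>n. 1 / of_nat (Suc n) powr s) sums g s"
  proof (rule holomorphic_sums_powr_bound[where f = "\<lambda>n s. 1 / of_nat (Suc n) powr s" and c = 0 and q = "\<lambda>_. 1"])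
    show "norm (1 / of_nat (Suc n) powr s) \<le> norm (1::complex) * real (Suc n) powr - (Re s + 0)" for n s
      using norm_powr_real_powr[of "of_nat (Suc n)" s]
      by (simp add: norm_divide powr_minus field_simps)
  qed (auto intro!: holomorphic_intros simp del: of_nat_Suc)
  show ?case
    by (intro exI[of _ "\<lambda>s. g s * (s - 1)"]) (use g in \<open>auto intro!: holomorphic_intros\<close>)
next
  case (Suc m)
  then obtain Z where Z: "Z holomorphic_on {s. Re s > 1 - real m}"
    "\<And>s. Re s > 1 \<Longrightarrow> (\<lambda>n. 1 / of_nat (Suc n) powr s) sums (Z s / (s - 1))" by blast
  define P :: "nat \<Rightarrow> complex \<Rightarrow> complex" where "P = (\<lambda>i c. \<Prod>l<i. c - of_nat l)"
  \<comment> \<open>The remainder decays with exponent \<open>Re s + Suc m\<close>, so the series of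
    remainders converges for Re s > -m, one strip further left than \<open>Z\<close>.\<close>
  define R :: "nat \<Rightarrow> complex \<Rightarrow> complex" where
    "R = (\<lambda>n s. of_real (real (Suc n) + 1) powr (1 - s) -
            (\<Sum>i\<le>Suc m. P i (1 - s) * of_real (real (Suc n)) powr (1 - s - of_nat i) / fact i))"
  define S where "S = {s. Re s > 1 - real (Suc m)}"
  have P1: "(\<lambda>s. P i (1 - s)) holomorphic_on A" for i A
    unfolding P_def by (intro holomorphic_intros)
  have "open S" unfolding S_def by (rule open_halfspace_Re_gt)
  then obtain G where G: "G holomorphic_on S" "\<And>s. s \<in> S \<Longrightarrow> (\<lambda>n. R n s) sums G s"
  proof (rule holomorphic_sums_powr_bound[where f = R and c = "Suc m" and q = "\<lambda>s. P (Suc (Suc m)) (1 - s)"])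
    show "R n holomorphic_on S" for n
      unfolding R_def by (intro holomorphic_intros P1) (auto simp flip: of_nat_Suc)
    show "continuous_on S (\<lambda>s. P (Suc (Suc m)) (1 - s))"
      by (intro holomorphic_on_imp_continuous_on P1)
    show "norm (R n s) \<le> norm (P (Suc (Suc m)) (1 - s)) * real (Suc n) powr - (Re s + real (Suc m))"
      if "s \<in> S" for n s
    proof -
      have "Re (1 - s) \<le> real (Suc (Suc m))" using that by (auto simp: S_def)
      then have "norm (R n s) \<le> norm (P (Suc (Suc m)) (1 - s)) * real (Suc n) powr (Re (1 - s) - real (Suc (Suc m)))"
        unfolding R_def P_def by (intro powr_taylor_bound) auto
      moreover have "Re (1 - s) - real (Suc (Suc m)) = - (Re s + real (Suc m))" by simp
      ultimately show ?thesis by (simp only:)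
    qed
  qed (auto simp: S_def)
  \<comment> \<open>The Taylor identity solved for its r = 0 term, which is Z(s) itself. Only shifts
    by r \<ge> 1 remain, and these stay in the half-plane where \<open>Z\<close> is already
    holomorphic.\<close>
  define Z' where "Z' = (\<lambda>s. 1 + G s - (\<Sum>r=1..m. P r (1 - s) / fact (Suc r) * Z (s + of_nat r)))"
  have "Z' holomorphic_on S"
  proof -
    have "(\<lambda>s. Z (s + of_nat r)) holomorphic_on S" if "r \<in> {1..m}" for r
      by (rule holomorphic_on_compose_gen[OF _ Z(1), of "\<lambda>s. s + of_nat r", unfolded o_def])
         (use that in \<open>auto intro!: holomorphic_intros simp: S_def\<close>)
    then show ?thesis unfolding Z'_def by (intro holomorphic_intros G P1) auto
  qed
  moreover have "Z' s = Z s" if s: "Re s > 1" for s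
  proof -
    have sS: "s \<in> S" using s by (auto simp: S_def)
    have pw: "of_real (real (Suc n)) powr (1 - s - of_nat (Suc r)) = 1 / of_nat (Suc n) powr (s + of_nat r)" for n r
      by (simp add: algebra_simps flip: powr_minus_divide)
    have t: "(\<lambda>n. P (Suc r) (1 - s) * of_real (real (Suc n)) powr (1 - s - of_nat (Suc r)) / fact (Suc r))
               sums (- (P r (1 - s) / fact (Suc r) * Z (s + of_nat r)))" for r
    proof -
      have ne: "s + of_nat r - 1 \<noteq> 0" using s by (auto simp: complex_eq_iff)
      have "P (Suc r) (1 - s) / fact (Suc r) * (Z (s + of_nat r) / (s + of_nat r - 1)) =
             - (P r (1 - s) / fact (Suc r) * Z (s + of_nat r))"
      proof -
        \<comment> \<open>The last factor of the falling product is the negated denominator of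
          \<open>Z (s + r) / (s + r - 1)\<close>, which is how the poles cancel.\<close>
        have "P (Suc r) (1 - s) = P r (1 - s) * - (s + of_nat r - 1)" by (simp add: P_def)
        moreover have "X * - w / c * (Y / w) = - (X / c * Y)" if "w \<noteq> 0" for X Y c w :: complex
          using that by simp
        ultimately show ?thesis using ne by metis
      qed
      moreover have "(\<lambda>n. P (Suc r) (1 - s) / fact (Suc r) * (1 / of_nat (Suc n) powr (s + of_nat r))) sums
             (P (Suc r) (1 - s) / fact (Suc r) * (Z (s + of_nat r) / (s + of_nat r - 1)))"
        by (intro sums_mult Z(2)) (use s in auto)
      ultimately show ?thesis unfolding pw by (simp add: field_simps)
    qed
    have tel: "(\<lambda>n. of_real (real (Suc n) + 1) powr (1 - s) - of_real (real (Suc n)) powr (1 - s)) sums (0 - (1::complex))"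
    proof -
      have "(\<lambda>n. of_nat (Suc n) powr (1 - s)) \<longlonglongrightarrow> (0::complex)"
      proof (rule tendsto_norm_zero_cancel)
        have "(\<lambda>n. real (Suc n) powr Re (1 - s)) \<longlonglongrightarrow> 0"
          using s by real_asymp
        then show "(\<lambda>n. norm (of_nat (Suc n) powr (1 - s))) \<longlonglongrightarrow> (0::real)"
          using norm_powr_real_powr[of "of_nat (Suc _)" "1 - s"] by (simp del: of_nat_Suc)
      qed
      from telescope_sums[OF this] show ?thesis by (simp add: add_ac)
    qed
    have "(\<lambda>n. (of_real (real (Suc n) + 1) powr (1 - s) - of_real (real (Suc n)) powr (1 - s))
        - (\<Sum>r\<le>m. P (Suc r) (1 - s) * of_real (real (Suc n)) powr (1 - s - of_nat (Suc r)) / fact (Suc r)))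
       sums ((0 - 1) - (\<Sum>r\<le>m. - (P r (1 - s) / fact (Suc r) * Z (s + of_nat r))))"
      by (intro sums_diff tel sums_sum t)
    moreover have "R n s = (of_real (real (Suc n) + 1) powr (1 - s) - of_real (real (Suc n)) powr (1 - s))
        - (\<Sum>r\<le>m. P (Suc r) (1 - s) * of_real (real (Suc n)) powr (1 - s - of_nat (Suc r)) / fact (Suc r))" for n
      unfolding R_def by (subst sum.atMost_Suc_shift) (simp add: P_def)
    ultimately have "G s = (0 - 1) - (\<Sum>r\<le>m. - (P r (1 - s) / fact (Suc r) * Z (s + of_nat r)))"
      using G(2)[OF sS] sums_unique2 by (simp only:)
    also have "\<dots> = -1 + Z s + (\<Sum>r=1..m. P r (1 - s) / fact (Suc r) * Z (s + of_nat r))"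
      by (simp add: sum_negf atMost_atLeast0 sum.atLeast_Suc_atMost P_def)
    finally show ?thesis by (simp add: Z'_def)
  qed
  ultimately show ?case unfolding S_def using Z(2) by (intro exI[of _ Z']) auto
qed

text \<open>The half-plane functions agree with each other by the identity theorem, starting from Re
  s > 1. Taking at each point the least admissible \<open>m\<close> glues them to an entire
  function, and division by s - 1 puts the pole back.\<close>

lemma is_zeta_continuation_exists: "\<exists>f. is_zeta_continuation f"
proof -
  obtain Z where hol: "\<And>m. Z m holomorphic_on {s. Re s > 1 - real m}"
    and sums: "\<And>m s. Re s > 1 \<Longrightarrow> (\<lambda>n. 1 / of_nat (Suc n) powr s) sums (Z m s / (s - 1))"
    using zeta_halfplane_continuation by metis
  have eq: "Z m s = Z m' s" if "m \<le> m'" "Re s > 1 - real m" for m m' s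
  proof (rule analytic_continuation_open[where f = "Z m" and g = "Z m'" and s = "{s. Re s > 1}"
        and s' = "{s. Re s > 1 - real m}"])
    show "{s. Re s > 1} \<noteq> {}" by (auto intro!: exI[of _ "2::complex"])
    show "connected {s. Re s > 1 - real m}" by (intro convex_connected convex_halfspace_Re_gt)
    show "Z m z = Z m' z" if "z \<in> {s. Re s > 1}" for z
    proof -
      have "Z m z / (z - 1) = Z m' z / (z - 1)"
        by (rule sums_unique2[OF sums sums]) (use that in auto)
      moreover have "z \<noteq> 1" using that by auto
      ultimately show ?thesis by simp
    qed
    show "Z m' holomorphic_on {s. Re s > 1 - real m}"
      by (rule holomorphic_on_subset[OF hol]) (use that in auto)
  qed (use that hol in \<open>auto simp: open_halfspace_Re_gt\<close>)
  define F where "F = (\<lambda>s. Z (LEAST m. Re s > 1 - real m) s)"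
  have F: "F s = Z m s" if "Re s > 1 - real m" for m s
  proof -
    have "Re s > 1 - real (LEAST m. Re s > 1 - real m)" using that by (rule LeastI)
    moreover have "(LEAST m. Re s > 1 - real m) \<le> m" using that by (rule Least_le)
    ultimately show ?thesis unfolding F_def by (intro eq)
  qed
  have "F holomorphic_on (\<Union>m. {s. Re s > 1 - real m})"
  proof (rule holomorphic_on_UN_open)
    show "F holomorphic_on {s. Re s > 1 - real m}" for m
      by (rule holomorphic_transform[OF hol]) (simp add: F)
  qed (auto simp: open_halfspace_Re_gt)
  moreover have "(\<Union>m. {s. Re s > 1 - real m}) = UNIV"
  proof -
    have "\<exists>m. 1 - real m < Re s" for s using reals_Archimedean2[of "1 - Re s"] by (auto simp: algebra_simps)
    then show ?thesis by auto
  qed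
  ultimately have F': "F holomorphic_on A" for A using holomorphic_on_subset by fastforce
  have "is_zeta_continuation (\<lambda>s. F s / (s - 1))"
    unfolding is_zeta_continuation_def
    using sums F[of 0] by (auto intro!: holomorphic_intros F' simp del: of_nat_Suc)
  then show ?thesis by blast
qed

lemma riemann_zeta: "is_zeta_continuation riemann_zeta"
  unfolding riemann_zeta_def using is_zeta_continuation_exists by (rule someI_ex)

section \<open>Euler-Maclaurin limit for zeta in the strip -1 < s < 1\<close>

text \<open>Trapezoidal errors of x^(-s) are O(n^(-Re s - 2)), so their series is holomorphic for Re
  s > -1. For Re s > 1 it is an explicit expression in zeta, and the identity theorem on the
  half-plane punctured at 1 carries this into the strip. The half term N^(-s)/2 is indispensable for
  s \<le> 0, where it does not tend to 0.\<close>

lemma tendsto_riemann_zeta: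
  fixes s :: real
  assumes s: "-1 < s" "s < 1"
  shows "(\<lambda>N. (\<Sum>j=1..N. real j powr -s) - real N powr (1 - s) / (1 - s) - real N powr -s / 2)
           \<longlonglongrightarrow> Re (riemann_zeta (of_real s))"
proof -
  \<comment> \<open>This is 1 - s times the trapezoidal rule minus the integral of x^(-s) over
    [n+1, n+2]; the factor 1 - s removes the denominator of the integral, so nothing singular
    happens at s = 1.\<close>
  define E :: "nat \<Rightarrow> complex \<Rightarrow> complex" where
    "E = (\<lambda>n s. (1 - s) * (of_nat (Suc n) powr -s + of_nat (Suc (Suc n)) powr -s) / 2
                - (of_nat (Suc (Suc n)) powr (1 - s) - of_nat (Suc n) powr (1 - s)))"
  \<comment> \<open>The product of the three falling factors of 1 - s, common to both Taylor
    remainders below; the 2 leaves room for adding them.\<close>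
  define q :: "complex \<Rightarrow> complex" where "q = (\<lambda>s. (1 - s) * (- s) * (- s - 1) * 2)"
  define S where "S = {s. Re s > -1}"
  have E_sum: "(\<Sum>n<N. E n s) = (1 - s) * ((\<Sum>j=1..Suc N. of_nat j powr -s) - 1 / 2 - of_nat (Suc N) powr -s / 2)
       + 1 - of_nat (Suc N) powr (1 - s)" for N s
  proof (induction N)
    case (Suc N)
    have "(\<Sum>j=1..Suc (Suc N). of_nat j powr -s) = (\<Sum>j=1..Suc N. of_nat j powr -s) + of_nat (Suc (Suc N)) powr -s"
      by (subst sum.cl_ivl_Suc) simp
    then show ?case
      unfolding sum.lessThan_Suc Suc.IH by (simp add: E_def field_simps del: of_nat_Suc sum.cl_ivl_Suc)
  qed (simp add: algebra_simps)
  have "open S" unfolding S_def by (rule open_halfspace_Re_gt)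
  then obtain G where G: "G holomorphic_on S" "\<And>s. s \<in> S \<Longrightarrow> (\<lambda>n. E n s) sums G s"
  proof (rule holomorphic_sums_powr_bound[where f = E and c = 2 and q = q])
    show "E n holomorphic_on S" for n
      unfolding E_def by (intro holomorphic_intros) (auto simp del: of_nat_Suc)
    show "continuous_on S q" unfolding q_def by (intro continuous_intros)
    show "norm (E n s) \<le> norm (q s) * real (Suc n) powr - (Re s + 2)" if "s \<in> S" for n s
    proof -
      define a where "a = real (Suc n)"
      define b where "b = complex_of_real a"
      define B where "B = norm (q s) * a powr - (Re s + 2)"
      define x where "x = of_real (a + 1) powr (1 - s) - (b powr (1 - s) + (1 - s) * b powr -s + (1 - s) * (- s) * b powr (- 1 - s) / 2)"
      define y where "y = of_real (a + 1) powr (- s) - (b powr (- s) + (- s) * b powr (- s - 1))"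
      have e: "Re (1 - s) - real (Suc 2) = - (Re s + 2)" "Re (- s) - real (Suc 1) = - (Re s + 2)" by auto
      have "norm x \<le> norm (\<Prod>l<Suc 2. (1 - s) - of_nat l) * a powr (Re (1 - s) - real (Suc 2))"
        using powr_taylor_bound[of a "1 - s" 2] that
        by (simp add: x_def a_def b_def S_def numeral_2_eq_2 algebra_simps)
      also have "(\<Prod>l<Suc 2. (1 - s) - of_nat l) = q s / 2"
        by (simp add: numeral_2_eq_2 q_def algebra_simps)
      finally have x: "norm x \<le> B / 2" unfolding e B_def by (simp add: norm_divide)
      have "norm y \<le> norm (\<Prod>l<Suc 1. - s - of_nat l) * a powr (Re (- s) - real (Suc 1))"
        using powr_taylor_bound[of a "- s" 1] that
        by (simp add: y_def a_def b_def S_def numeral_2_eq_2 algebra_simps)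
      then have "norm (1 - s) * norm y \<le> norm (1 - s) * (norm (\<Prod>l<Suc 1. - s - of_nat l) * a powr - (Re s + 2))"
        unfolding e by (intro mult_left_mono) auto
      also have "norm (\<Prod>l<Suc 1. - s - of_nat l) = norm (- s) * norm (- s - 1)"
        by (simp add: norm_mult)
      also have "norm (1 - s) * (norm (- s) * norm (- s - 1) * a powr - (Re s + 2)) = B / 2"
        unfolding B_def q_def norm_mult by simp
      finally have y: "norm (1 - s) * norm y \<le> B / 2" .
      have e3: "- s - 1 = - 1 - s" by simp
      \<comment> \<open>All Taylor terms cancel: the trapezoidal rule is exact up to this order, and
        only the two remainders survive.\<close>
      have "E n s = (1 - s) * y / 2 - x"
        by (simp add: E_def x_def y_def[unfolded e3] b_def a_def field_simps)
      then have "norm (E n s) \<le> norm ((1 - s) * y / 2) + norm x" using norm_triangle_ineq4 by metis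
      also have "norm ((1 - s) * y / 2) = norm (1 - s) * norm y / 2" by (simp add: norm_mult norm_divide)
      finally have "norm (E n s) \<le> norm (1 - s) * norm y / 2 + norm x" .
      then show ?thesis using x y norm_ge_zero[of y] norm_ge_zero[of "1 - s"] norm_ge_zero[of x] unfolding B_def a_def by linarith
    qed
  qed (auto simp: S_def)
  have eq: "G z = (1 - z) * (riemann_zeta z - 1 / 2) + 1" if "z \<in> S - {1}" for z
  proof (rule analytic_continuation_open[where f = G and g = "\<lambda>z. (1 - z) * (riemann_zeta z - 1 / 2) + 1"
        and s = "{s. Re s > 1}" and s' = "S - {1}"])
    show "{s. Re s > 1} \<noteq> {}" by (auto intro!: exI[of _ "2::complex"])
    show "open (S - {1})" using \<open>open S\<close> by (rule open_delete)
    have "connected S" unfolding S_def by (intro convex_connected convex_halfspace_Re_gt)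
    with \<open>open S\<close> show "connected (S - {1})" by (intro connected_open_delete) auto
    show "G holomorphic_on S - {1}" using G(1) by (rule holomorphic_on_subset) auto
    have "riemann_zeta holomorphic_on S - {1}"
      using riemann_zeta unfolding is_zeta_continuation_def by (auto elim: holomorphic_on_subset)
    then show "(\<lambda>z. (1 - z) * (riemann_zeta z - 1 / 2) + 1) holomorphic_on S - {1}"
      by (intro holomorphic_intros)
    show "G z = (1 - z) * (riemann_zeta z - 1 / 2) + 1" if "z \<in> {s. Re s > 1}" for z
    proof (rule LIMSEQ_unique)
      have zS: "z \<in> S" using that by (auto simp: S_def)
      show "(\<lambda>N. \<Sum>n<N. E n z) \<longlonglongrightarrow> G z" using G(2)[OF zS] by (simp add: sums_def)
      have pw: "(\<lambda>N. of_nat (Suc N) powr w) \<longlonglongrightarrow> (0::complex)" if "Re w < 0" for w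
      proof (rule tendsto_norm_zero_cancel)
        have "(\<lambda>N. real (Suc N) powr Re w) \<longlonglongrightarrow> 0" using that by real_asymp
        then show "(\<lambda>N. norm (of_nat (Suc N) powr w)) \<longlonglongrightarrow> (0::real)"
          using norm_powr_real_powr[of "of_nat (Suc _)" w] by (simp del: of_nat_Suc)
      qed
      have "(\<lambda>n. 1 / of_nat (Suc n) powr z) sums riemann_zeta z"
        using riemann_zeta that by (auto simp: is_zeta_continuation_def)
      then have "(\<lambda>N. \<Sum>n<Suc N. 1 / of_nat (Suc n) powr z) \<longlonglongrightarrow> riemann_zeta z"
        unfolding sums_def by (rule LIMSEQ_Suc)
      moreover have "(\<Sum>n<Suc N. 1 / of_nat (Suc n) powr z) = (\<Sum>j=1..Suc N. of_nat j powr -z)" for N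
        by (simp add: powr_minus_divide sum.atLeast1_atMost_eq del: of_nat_Suc)
      ultimately have "(\<lambda>N. \<Sum>j=1..Suc N. of_nat j powr -z) \<longlonglongrightarrow> riemann_zeta z" by (simp only:)
      then have "(\<lambda>N. (1 - z) * ((\<Sum>j=1..Suc N. of_nat j powr -z) - 1 / 2 - of_nat (Suc N) powr -z / 2)
          + 1 - of_nat (Suc N) powr (1 - z)) \<longlonglongrightarrow> (1 - z) * (riemann_zeta z - 1 / 2 - 0 / 2) + 1 - 0"
        using that by (intro tendsto_intros pw) auto
      then show "(\<lambda>N. \<Sum>n<N. E n z) \<longlonglongrightarrow> (1 - z) * (riemann_zeta z - 1 / 2) + 1"
        unfolding E_sum by simp
    qed
  qed (use that \<open>open S\<close> in \<open>auto simp: open_halfspace_Re_gt S_def\<close>)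
  define z where "z = complex_of_real s"
  have z: "z \<in> S - {1}" using s by (auto simp: S_def z_def)
  define T where "T = (\<lambda>N. (\<Sum>j=1..N. real j powr -s) - real N powr (1 - s) / (1 - s) - real N powr -s / 2)"
  have "(\<lambda>N. \<Sum>n<N. E n z) \<longlonglongrightarrow> (1 - z) * (riemann_zeta z - 1 / 2) + 1"
    using G(2)[of z] z eq[OF z] by (simp add: sums_def)
  from tendsto_Re[OF this] have lim: "(\<lambda>N. Re (\<Sum>n<N. E n z)) \<longlonglongrightarrow> (1 - s) * (Re (riemann_zeta z) - 1 / 2) + 1"
    by (simp add: z_def)
  have "Re (\<Sum>n<N. E n z) = (1 - s) * (T (Suc N) - 1 / 2) + 1" for N
  proof -
    have pw: "of_nat j powr complex_of_real x = of_real (real j powr x)" for j x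
      using powr_of_real[of "real j" x] by simp
    have pw1: "of_nat j powr - complex_of_real s = of_real (real j powr -s)" for j
      using pw[of j "-s"] by simp
    have pw2: "of_nat j powr (1 - complex_of_real s) = of_real (real j powr (1 - s))" for j
      using pw[of j "1 - s"] by simp
    have "(\<Sum>n<N. E n z) = of_real ((1 - s) * ((\<Sum>j=1..Suc N. real j powr -s) - 1 / 2 - real (Suc N) powr -s / 2)
       + 1 - real (Suc N) powr (1 - s))"
      unfolding E_sum z_def pw1 pw2 by (simp del: of_nat_Suc)
    then have "Re (\<Sum>n<N. E n z) = (1 - s) * ((\<Sum>j=1..Suc N. real j powr -s) - 1 / 2 - real (Suc N) powr -s / 2)
       + 1 - real (Suc N) powr (1 - s)" by (simp only: Re_complex_of_real)
    also have "\<dots> = (1 - s) * (T (Suc N) - 1 / 2) + 1"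
      using s unfolding T_def by (simp add: field_simps)
    finally show ?thesis .
  qed
  with lim have lim': "(\<lambda>N. (1 - s) * (T (Suc N) - 1 / 2) + 1) \<longlonglongrightarrow> (1 - s) * (Re (riemann_zeta z) - 1 / 2) + 1" by simp
  have "(\<lambda>N. (((1 - s) * (T (Suc N) - 1 / 2) + 1) - 1) / (1 - s) + 1 / 2) \<longlonglongrightarrow>
       (((1 - s) * (Re (riemann_zeta z) - 1 / 2) + 1) - 1) / (1 - s) + 1 / 2"
    using s by (intro tendsto_add[OF tendsto_divide[OF tendsto_diff[OF lim']]] tendsto_const) auto
  moreover have "((1 - s) * (X - 1 / 2) + 1 - 1) / (1 - s) + 1 / 2 = X" for X using s by simp
  ultimately have "(\<lambda>N. T (Suc N)) \<longlonglongrightarrow> Re (riemann_zeta z)" by (simp only:)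
  then show ?thesis unfolding T_def z_def by (rule LIMSEQ_imp_Suc)
qed

subsection \<open>Quadrature errors on unit cells\<close>

text \<open>Asymptotic expansions say nothing about the first cells, but the cell errors are summed
  from index 0. Since \<open>g\<close> is positive, the finitely many exceptions can be absorbed
  into the constant.\<close>

lemma sequence_bigo_bound:
  fixes f g :: "nat \<Rightarrow> real"
  assumes "f \<in> O(g)" and g: "\<And>n. g n > 0"
  obtains C where "C \<ge> 0" "\<And>n. \<bar>f n\<bar> \<le> C * g n"
proof -
  obtain c N where c: "c > 0" "\<And>n. n \<ge> N \<Longrightarrow> \<bar>f n\<bar> \<le> c * \<bar>g n\<bar>"
    using landau_o.bigE[OF assms(1)] unfolding eventually_sequentially by (metis real_norm_def)
  define C where "C = c + (\<Sum>n<N. \<bar>f n\<bar> / g n)"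
  have nn: "(\<Sum>n<N. \<bar>f n\<bar> / g n) \<ge> 0" using g by (intro sum_nonneg divide_nonneg_pos) auto
  have "\<bar>f n\<bar> \<le> C * g n" for n
  proof (cases "n \<ge> N")
    case True
    then have "\<bar>f n\<bar> \<le> c * g n" using c(2)[of n] g[of n] by simp
    also have "\<dots> \<le> C * g n" using nn g[of n] by (intro mult_right_mono) (auto simp: C_def)
    finally show ?thesis .
  next
    case False
    then have "\<bar>f n\<bar> / g n \<le> (\<Sum>n<N. \<bar>f n\<bar> / g n)"
      using g by (intro member_le_sum) (auto intro!: divide_nonneg_pos)
    then have "\<bar>f n\<bar> / g n \<le> C" using c by (simp add: C_def)
    then show ?thesis using g[of n] by (simp add: field_simps)
  qed
  moreover have "C \<ge> 0" using nn c by (simp add: C_def)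
  ultimately show ?thesis using that by blast
qed

text \<open>The absolute value in \<open>4 powr \<bar>p\<bar>\<close> covers increasing and
  decreasing powers at once, so the sign of exponents such as b - 2 does not matter later.\<close>

lemma powr_le_comparable:
  fixes x n p :: real
  assumes "n / 4 \<le> x" "x \<le> n" "0 < n"
  shows "x powr p \<le> 4 powr \<bar>p\<bar> * n powr p"
proof (cases "p \<ge> 0")
  case True
  then have "x powr p \<le> 1 * n powr p" using assms by (simp add: powr_mono2)
  also have "\<dots> \<le> 4 powr \<bar>p\<bar> * n powr p"
    by (intro mult_right_mono) (auto simp: ge_one_powr_ge_zero)
  finally show ?thesis .
next
  case False
  then have "x powr p \<le> (n / 4) powr p" using assms by (intro powr_mono2') auto
  also have "\<dots> = 4 powr \<bar>p\<bar> * n powr p"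
    using assms False by (simp add: powr_divide powr_minus field_simps)
  finally show ?thesis .
qed

lemma summable_Suc_powr: "0 < a \<Longrightarrow> summable (\<lambda>j. (real j + 1) powr (-1 - a))"
  using summable_Suc_iff[of "\<lambda>j. real j powr (-1 - a)"] summable_real_powr_iff[of "-1 - a"]
  by (simp add: add.commute)

text \<open>Split off the summable factor (j+1)^(-1-a); the other factor is increasing and at most
  its value at N. Giving away N^a avoids a logarithm at p = -1 and a case distinction there.\<close>

lemma sum_powr_le:
  assumes "0 < a" "p \<ge> -1 - a"
  shows "(\<Sum>j<N. (real j + 1) powr p) \<le> (\<Sum>j. (real j + 1) powr (-1 - a)) * real N powr (p + 1 + a)"
proof -
  have "(\<Sum>j<N. (real j + 1) powr p) \<le> (\<Sum>j<N. (real j + 1) powr (-1 - a) * real N powr (p + 1 + a))"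
  proof (rule sum_mono)
    fix j assume "j \<in> {..<N}"
    then have "(real j + 1) powr (p + 1 + a) \<le> real N powr (p + 1 + a)"
      using assms by (intro powr_mono2) auto
    then have "(real j + 1) powr (-1 - a) * (real j + 1) powr (p + 1 + a) \<le> (real j + 1) powr (-1 - a) * real N powr (p + 1 + a)"
      by (intro mult_left_mono) auto
    then show "(real j + 1) powr p \<le> (real j + 1) powr (-1 - a) * real N powr (p + 1 + a)"
      by (simp flip: powr_add)
  qed
  also have "\<dots> \<le> (\<Sum>j. (real j + 1) powr (-1 - a)) * real N powr (p + 1 + a)"
    unfolding sum_distrib_right[symmetric] using summable_Suc_powr[OF assms(1)]
    by (intro mult_right_mono sum_le_suminf) auto
  finally show ?thesis .
qed

text \<open>The counterpart of \<open>sum_powr_le\<close> for tails: the factor split off beside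
  (j+1)^(-1-a) is now decreasing, hence largest at the first omitted index.\<close>

lemma sums_powr_tail:
  fixes u :: "nat \<Rightarrow> real"
  assumes a: "0 < a" and p: "p \<le> -1 - a" and u: "\<And>j. \<bar>u j\<bar> \<le> C * (real j + 1) powr p"
    and s: "u sums s"
  shows "\<bar>(\<Sum>j<N. u j) - s\<bar> \<le> C * (\<Sum>j. (real j + 1) powr (-1 - a)) * (real N + 1) powr (p + 1 + a)"
proof -
  define g where "g = (\<lambda>j. (real j + 1) powr (-1 - a))"
  have g: "summable g" unfolding g_def by (rule summable_Suc_powr[OF a])
  have C: "C \<ge> 0" using u[of 0] by simp
  define T where "T = (real N + 1) powr (p + 1 + a)"
  have b: "\<bar>u (j + N)\<bar> \<le> C * T * g (j + N)" for j
  proof -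
    have "(real (j + N) + 1) powr (p + 1 + a) \<le> T"
      unfolding T_def using p by (intro powr_mono2') auto
    then have "g (j + N) * (real (j + N) + 1) powr (p + 1 + a) \<le> g (j + N) * T"
      by (intro mult_left_mono) (auto simp: g_def)
    moreover have "g (j + N) * (real (j + N) + 1) powr (p + 1 + a) = (real (j + N) + 1) powr p"
      unfolding g_def by (simp flip: powr_add)
    ultimately have "C * (real (j + N) + 1) powr p \<le> C * (g (j + N) * T)"
      using C by (intro mult_left_mono) auto
    then show ?thesis using u[of "j + N"] by (simp add: mult_ac)
  qed
  have gN: "summable (\<lambda>j. C * T * g (j + N))" using g by (intro summable_mult summable_ignore_initial_segment)
  have "s - (\<Sum>j<N. u j) = (\<Sum>j. u (j + N))"
    using s suminf_minus_initial_segment[of u N] by (simp add: sums_iff)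
  moreover have "\<bar>\<Sum>j. u (j + N)\<bar> \<le> (\<Sum>j. C * T * g (j + N))"
    using norm_suminf_le[of "\<lambda>j. u (j + N)", OF _ gN] b by simp
  moreover have "(\<Sum>j. C * T * g (j + N)) = C * T * (\<Sum>j. g (j + N))"
    using g by (intro suminf_mult summable_ignore_initial_segment)
  moreover have "C * T * (\<Sum>j. g (j + N)) \<le> C * T * suminf g"
  proof -
    have "(\<Sum>j. g (j + N)) = suminf g - (\<Sum>j<N. g j)"
      using g by (rule suminf_minus_initial_segment)
    moreover have "(\<Sum>j<N. g j) \<ge> 0" by (intro sum_nonneg) (auto simp: g_def)
    ultimately show ?thesis using C by (intro mult_left_mono) (auto simp: T_def)
  qed
  ultimately show ?thesis unfolding T_def g_def by (simp add: mult_ac)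
qed

section \<open>Midpoint and trapezoidal errors of powers, and their sums\<close>

text \<open>Midpoint rule minus integral of s^(-a) over [k, k+1].\<close>

definition midpoint_err :: "real \<Rightarrow> nat \<Rightarrow> real" where
  "midpoint_err a k = (real k + 1 / 2) powr -a - ((real k + 1) powr (1 - a) - real k powr (1 - a)) / (1 - a)"

text \<open>Integral minus rule for x^b over [j, j+1], the sign opposite to
  \<open>midpoint_err\<close>: it is then the integral of b x^(b-1) (m - x), with m the
  midpoint.\<close>

definition trapezoid_err :: "real \<Rightarrow> nat \<Rightarrow> real" where
  "trapezoid_err b j = ((real j + 1) powr (b + 1) - real j powr (b + 1)) / (b + 1) -
     ((real j + 1) powr b + real j powr b) / 2"

lemma midpoint_err_bound:
  assumes "0 < a" "a < 1"
  obtains C where "C \<ge> 0" "\<And>k. \<bar>midpoint_err a k\<bar> \<le> C * (real k + 1) powr (-a - 2)"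
proof -
  have "midpoint_err a \<in> O(\<lambda>k. (real k + 1) powr (-a - 2))"
    unfolding midpoint_err_def[abs_def] using assms by real_asymp
  from sequence_bigo_bound[OF this] show ?thesis using that by auto
qed

lemma trapezoid_err_bound:
  assumes "0 < b"
  obtains C where "C \<ge> 0" "\<And>k. \<bar>trapezoid_err b k\<bar> \<le> C * (real k + 1) powr (b - 2)"
proof -
  have "trapezoid_err b \<in> O(\<lambda>k. (real k + 1) powr (b - 2))"
  \<comment> \<open>The leading coefficient of the error contains the factor b - 1; for b = 1 the
    rule is exact.\<close>
  proof (cases "b = 1")
    case True
    then have "trapezoid_err b = (\<lambda>_. 0)"
      by (auto simp: trapezoid_err_def fun_eq_iff power2_eq_square field_simps)
    then show ?thesis by simp
  next
    case False
    then show ?thesis unfolding trapezoid_err_def[abs_def] using assms by real_asymp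
  qed
  from sequence_bigo_bound[OF this] show ?thesis using that by auto
qed

text \<open>The half-integers are the odd numbers divided by 2, so their power sum is 2^a H(2N) -
  H(N). The same combination of the normalized sums \<open>T\<close> reproduces the integral
  exactly, and its boundary terms N^(-a)/2 cancel.\<close>

lemma midpoint_err_sums:
  assumes "0 < a" "a < 1"
  shows "midpoint_err a sums ((2 powr a - 1) * Re (riemann_zeta (of_real a)))"
proof -
  define H where "H = (\<lambda>N. \<Sum>j=1..N. real j powr -a)"
  define T where "T = (\<lambda>N. H N - real N powr (1 - a) / (1 - a) - real N powr -a / 2)"
  have lim: "T \<longlonglongrightarrow> Re (riemann_zeta (of_real a))"
    using tendsto_riemann_zeta[of a] assms unfolding T_def H_def by simp
  have half: "(real k + 1 / 2) powr -a = 2 powr a * (real (2 * k + 1)) powr -a" for k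
  proof -
    have "real k + 1 / 2 = real (2 * k + 1) / 2" by simp
    then show ?thesis by (simp only: powr_divide of_nat_0_le_iff) (simp add: powr_minus field_simps)
  qed
  have sum_half: "(\<Sum>k<N. (real k + 1 / 2) powr -a) = 2 powr a * H (2 * N) - H N" for N
  proof (induction N)
    case (Suc N)
    have "H (2 * Suc N) = H (2 * N) + real (2 * N + 1) powr -a + real (2 * Suc N) powr -a"
      by (simp add: H_def)
    moreover have "H (Suc N) = H N + real (Suc N) powr -a" by (simp add: H_def)
    moreover have "2 powr a * real (2 * Suc N) powr -a = real (Suc N) powr -a"
      unfolding of_nat_mult by (simp only: powr_mult of_nat_0_le_iff) (simp add: powr_minus field_simps)
    ultimately show ?case using Suc by (simp add: half algebra_simps del: of_nat_Suc)
  qed (simp add: H_def)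
  have sum_int: "(\<Sum>k<N. ((real k + 1) powr (1 - a) - real k powr (1 - a)) / (1 - a)) = real N powr (1 - a) / (1 - a)" for N
    unfolding sum_divide_distrib[symmetric]
    using sum_lessThan_telescope[of "\<lambda>k. real k powr (1 - a)" N] assms by (simp add: add.commute)
  have "(\<Sum>k<N. midpoint_err a k) = 2 powr a * T (2 * N) - T N" for N
  proof -
    have e: "2 powr a * real (2 * N) powr (1 - a) = 2 * real N powr (1 - a)"
      "2 powr a * real (2 * N) powr - a = real N powr - a"
      by (simp_all add: powr_mult powr_diff powr_minus field_simps)
    have "2 powr a * T (2 * N) - T N = 2 powr a * H (2 * N) - H N - (2 powr a * real (2 * N) powr (1 - a) - real N powr (1 - a)) / (1 - a)
       - (2 powr a * real (2 * N) powr - a - real N powr - a) / 2"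
      unfolding T_def by (simp add: algebra_simps diff_divide_distrib)
    then show ?thesis unfolding midpoint_err_def sum_subtractf sum_half sum_int e by simp
  qed
  moreover have "(\<lambda>N. 2 powr a * T (2 * N) - T N) \<longlonglongrightarrow> 2 powr a * Re (riemann_zeta (of_real a)) - Re (riemann_zeta (of_real a))"
    using filterlim_compose[OF lim mult_nat_left_at_top[of 2]] lim by (intro tendsto_intros) auto
  ultimately show ?thesis unfolding sums_def left_diff_distrib mult_1_left by (simp only:)
qed

text \<open>The normalized power sums telescope into trapezoidal errors. With b < 1 the point -b
  lies in the strip of \<open>tendsto_riemann_zeta\<close>.\<close>

lemma trapezoid_err_sums:
  assumes "0 < b" "b < 1"
  shows "trapezoid_err b sums (- Re (riemann_zeta (of_real (- b))))"
proof -
  define T where "T = (\<lambda>N. (\<Sum>j=1..N. real j powr b) - real N powr (b + 1) / (b + 1) - real N powr b / 2)"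
  have lim: "T \<longlonglongrightarrow> Re (riemann_zeta (of_real (- b)))"
    using tendsto_riemann_zeta[of "- b"] assms unfolding T_def by (simp add: add.commute)
  have "(\<Sum>j<N. trapezoid_err b j) = - T N" for N
  proof (induction N)
    case (Suc N)
    have "T (Suc N) = T N - trapezoid_err b N"
      by (simp add: T_def trapezoid_err_def diff_divide_distrib add_divide_distrib add.commute)
    with Suc show ?case by simp
  qed (use assms in \<open>simp add: T_def\<close>)
  then show ?thesis unfolding sums_def using tendsto_minus[OF lim] by simp
qed

text \<open>The exponent b - 1 + a is the largest that can be afforded: this sum is later multiplied
  by n^(-a-1), which gives n^(b-2).\<close>

lemma trapezoid_err_partial_sum:
  assumes a: "0 < a" "a < 1" and b: "0 < b"
  obtains C where "C \<ge> 0" "\<And>N. N \<ge> 1 \<Longrightarrow>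
     \<bar>(\<Sum>j<N. trapezoid_err b j) + Re (riemann_zeta (of_real (- b)))\<bar> \<le> C * real N powr (b - 1 + a)"
proof -
  define z where "z = Re (riemann_zeta (of_real (- b)))"
  define K where "K = (\<Sum>j. (real j + 1) powr (-1 - a))"
  have K: "K \<ge> 0" unfolding K_def using summable_Suc_powr[OF a(1)] by (intro suminf_nonneg) auto
  obtain C where C: "C \<ge> 0" "\<And>k. \<bar>trapezoid_err b k\<bar> \<le> C * (real k + 1) powr (b - 2)"
    using trapezoid_err_bound[OF b] by blast
  show ?thesis
  \<comment> \<open>The cut is where p = b - 2 passes -1 - a: below it the tail bound applies, above
    it the partial-sum bound. Above it N^(b-1+a) is at least 1, so zeta(-b) enters merely as a
    constant.\<close>
  proof (cases "b \<le> 1 - a")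
    case True
    have "\<bar>(\<Sum>j<N. trapezoid_err b j) + z\<bar> \<le> C * K * real N powr (b - 1 + a)" if "N \<ge> 1" for N
    proof -
      have "\<bar>(\<Sum>j<N. trapezoid_err b j) - (- z)\<bar> \<le> C * K * (real N + 1) powr (b - 2 + 1 + a)"
        unfolding K_def z_def using True a b
        by (intro sums_powr_tail C trapezoid_err_sums) auto
      also have "\<dots> \<le> C * K * real N powr (b - 2 + 1 + a)"
        using that True C K by (intro mult_left_mono powr_mono2') auto
      finally show ?thesis by (simp add: algebra_simps)
    qed
    then show ?thesis using that[of "C * K"] C K unfolding z_def by simp
  next
    case False
    have "\<bar>(\<Sum>j<N. trapezoid_err b j) + z\<bar> \<le> (C * K + \<bar>z\<bar>) * real N powr (b - 1 + a)" if "N \<ge> 1" for N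
    proof -
      have "\<bar>\<Sum>j<N. trapezoid_err b j\<bar> \<le> (\<Sum>j<N. C * (real j + 1) powr (b - 2))"
        using C(2) by (intro order_trans[OF sum_abs] sum_mono)
      also have "\<dots> \<le> C * (K * real N powr (b - 2 + 1 + a))"
        unfolding K_def sum_distrib_left[symmetric] using a False
        by (intro mult_left_mono C sum_powr_le) auto
      finally have "\<bar>\<Sum>j<N. trapezoid_err b j\<bar> \<le> C * K * real N powr (b - 1 + a)"
        by (simp add: algebra_simps)
      moreover have "\<bar>z\<bar> * 1 \<le> \<bar>z\<bar> * real N powr (b - 1 + a)"
        using that False by (intro mult_left_mono ge_one_powr_ge_zero) auto
      ultimately show ?thesis by (simp add: algebra_simps)
    qed
    then show ?thesis using that[of "C * K + \<bar>z\<bar>"] C K unfolding z_def by simp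
  qed
qed

section \<open>Error of a single cell\<close>

lemma powr_lipschitz_ivl:
  fixes x y l r p B :: real
  assumes "0 < l" "x \<in> {l..r}" "y \<in> {l..r}" "\<And>z. z \<in> {l..r} \<Longrightarrow> \<bar>p\<bar> * z powr (p - 1) \<le> B"
  shows "\<bar>x powr p - y powr p\<bar> \<le> B * \<bar>x - y\<bar>"
proof -
  have "norm (x powr p - y powr p) \<le> B * norm (x - y)"
  proof (rule field_differentiable_bound[where S = "{l..r}" and f' = "\<lambda>z. p * z powr (p - 1)"])
    show "((\<lambda>z. z powr p) has_field_derivative p * z powr (p - 1)) (at z within {l..r})" if "z \<in> {l..r}" for z
      using that assms by (auto intro!: derivative_eq_intros)
    show "norm (p * z powr (p - 1)) \<le> B" if "z \<in> {l..r}" for z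
      using assms(4)[OF that] by (simp add: abs_mult)
  qed (use assms in auto)
  then show ?thesis by simp
qed

lemma has_integral_norm_bound:
  fixes f g :: "real \<Rightarrow> real"
  assumes "(f has_integral i) S" "(g has_integral k) S" "\<And>x. x \<in> S \<Longrightarrow> norm (f x) \<le> g x"
  shows "norm i \<le> k"
  using integral_norm_bound_integral[of f S g] assms by (metis has_integral_integrable integral_unique)

text \<open>The left end may be 0, where the derivative of x^b is unbounded for b < 1; hence the
  fundamental theorem with derivatives in the interior and continuity up to the ends.\<close>

lemma has_integral_powr_ivl:
  fixes b l r :: real
  assumes "0 < b" "0 \<le> l" "l \<le> r"
  shows "((\<lambda>x. b * x powr (b - 1)) has_integral (r powr b - l powr b)) {l..r}"
proof (rule fundamental_theorem_of_calculus_interior)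
  show "continuous_on {l..r} (\<lambda>x. x powr b)"
    using assms by (intro continuous_on_powr' continuous_intros) auto
  show "((\<lambda>x. x powr b) has_vector_derivative b * x powr (b - 1)) (at x)" if "x \<in> {l<..<r}" for x
    using that assms unfolding has_real_derivative_iff_has_vector_derivative[symmetric]
    by (auto intro!: derivative_eq_intros)
qed (use assms in auto)

text \<open>The weight is expanded to second order at the midpoint of the cell; the integral of the
  linear term against \<open>b x\<^sup>b\<^sup>-\<^sup>1\<close> is exactly the trapezoidal error of \<open>x\<^sup>b\<close>.\<close>
lemma cell_err_smooth_weight:
  fixes a b n :: real and j :: nat
  assumes a: "0 < a" "a < 1" and b: "0 < b" and n: "0 < n" and j: "real j + 1 \<le> 3 / 4 * n"
    and int: "(\<lambda>x. x powr (b - 1) * (n - x) powr -a) integrable_on {real j..real j + 1}"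
  shows "\<bar>(n - (real j + 1 / 2)) powr -a * ((real j + 1) powr b - real j powr b)
           - b * integral {real j..real j + 1} (\<lambda>x. x powr (b - 1) * (n - x) powr -a)
           - a * (n - (real j + 1 / 2)) powr (-a - 1) * trapezoid_err b j\<bar>
         \<le> (2 * 4 powr (a + 2)) * n powr (-a - 2) * ((real j + 1) powr b - real j powr b)"
proof -
  define S where "S = {real j..real j + 1}"
  define m where "m = real j + 1 / 2"
  \<comment> \<open>The derivatives of (n - x)^(-a): the sign from the exponent and the sign from n
    - x cancel, which leaves a rising factorial.\<close>
  define f where "f = (\<lambda>i x. pochhammer a i * (n - x) powr (- a - real i))"
  define B where "B = (2 * 4 powr (a + 2)) * n powr (-a - 2)"
  define G where "G = (\<lambda>x. f 0 m - f 0 x - f 1 m * (m - x))"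
  have G: "\<bar>G x\<bar> \<le> B" if x: "x \<in> S" for x
  proof -
    have "norm (f 0 x - (\<Sum>i\<le>1. f i m * (x - m) ^ i / fact i)) \<le> B * norm (x - m) ^ Suc 1 / fact 1"
    proof (rule field_Taylor[where S = S])
      show "(f i has_field_derivative f (Suc i) x) (at x within S)" if "x \<in> S" for i x
        unfolding f_def using that j n
        by (auto intro!: derivative_eq_intros simp: S_def pochhammer_Suc algebra_simps)
      show "norm (f (Suc 1) x) \<le> B" if "x \<in> S" for x
      proof -
        have "(n - x) powr (- a - 2) \<le> 4 powr \<bar>- a - 2\<bar> * n powr (- a - 2)"
          using that j n by (intro powr_le_comparable) (auto simp: S_def)
        moreover have "a * (a + 1) \<le> 1 * 2" using a by (intro mult_mono) auto
        ultimately have "a * (a + 1) * (n - x) powr (- a - 2) \<le> (1 * 2) * (4 powr \<bar>- a - 2\<bar> * n powr (- a - 2))"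
          using a by (intro mult_mono) auto
        moreover have "\<bar>- a - 2\<bar> = a + 2" using a by simp
        ultimately show ?thesis using a
          by (simp only:) (simp add: f_def B_def pochhammer_Suc abs_mult numeral_2_eq_2 mult.assoc)
      qed
    qed (use x in \<open>auto simp: S_def m_def\<close>)
    also have "B * norm (x - m) ^ Suc 1 / fact 1 \<le> B * 1 ^ Suc 1 / fact 1"
      using x by (intro divide_right_mono mult_left_mono power_mono) (auto simp: S_def m_def B_def)
    finally have "\<bar>f 0 x - (f 0 m + f 1 m * (x - m))\<bar> \<le> B" by simp
    moreover have "f 0 x - (f 0 m + f 1 m * (x - m)) = - G x" by (simp add: G_def algebra_simps)
    ultimately show ?thesis by simp
  qed
  define \<Delta> where "\<Delta> = (real j + 1) powr b - real j powr b"
  define I where "I = integral S (\<lambda>x. x powr (b - 1) * (n - x) powr -a)"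
  have h1: "((\<lambda>x. b * x powr (b - 1)) has_integral \<Delta>) S"
    unfolding S_def \<Delta>_def using b by (intro has_integral_powr_ivl) auto
  have h2: "((\<lambda>x. x powr (b - 1) * (n - x) powr -a) has_integral I) S"
    using int unfolding S_def I_def by (rule integrable_integral)
  have h3: "((\<lambda>x. (b + 1) * x powr b) has_integral ((real j + 1) powr (b + 1) - real j powr (b + 1))) S"
    using has_integral_powr_ivl[of "b + 1" "real j" "real j + 1"] b by (simp add: S_def)
  have h4: "((\<lambda>x. (b * x powr (b - 1)) * m - b / (b + 1) * ((b + 1) * x powr b)) has_integral trapezoid_err b j) S"
  proof -
    have p: "x powr (b + 1) = x * x powr b" if "x \<ge> 0" for x :: real
      using that by (cases "x = 0") (auto simp: powr_add)
    have "((\<lambda>x. (b * x powr (b - 1)) * m - b / (b + 1) * ((b + 1) * x powr b)) has_integral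
            (\<Delta> * m - b / (b + 1) * ((real j + 1) powr (b + 1) - real j powr (b + 1)))) S"
      by (intro has_integral_diff has_integral_mult_left has_integral_mult_right h1 h3)
    also have "\<Delta> * m - b / (b + 1) * ((real j + 1) powr (b + 1) - real j powr (b + 1)) = trapezoid_err b j"
      using b by (simp add: \<Delta>_def m_def trapezoid_err_def p divide_simps) (simp add: algebra_simps)
    finally show ?thesis .
  qed
  have h5: "((\<lambda>x. b * x powr (b - 1) * f 0 m - b * (x powr (b - 1) * (n - x) powr -a) -
            f 1 m * ((b * x powr (b - 1)) * m - b / (b + 1) * ((b + 1) * x powr b)))
          has_integral (\<Delta> * f 0 m - b * I - f 1 m * trapezoid_err b j)) S"
    by (intro has_integral_diff has_integral_mult_left has_integral_mult_right h1 h2 h4)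
  have eq: "b * x powr (b - 1) * f 0 m - b * (x powr (b - 1) * (n - x) powr -a) -
            f 1 m * ((b * x powr (b - 1)) * m - b / (b + 1) * ((b + 1) * x powr b)) = b * x powr (b - 1) * G x"
    if "x \<in> S" for x
  proof -
    have "x powr b = x powr (b - 1) * x"
      using that by (cases "x = 0") (auto simp: S_def powr_diff)
    moreover have "b / (b + 1) * ((b + 1) * y) = b * y" for y using b by simp
    ultimately show ?thesis by (simp only: G_def f_def) (simp add: algebra_simps)
  qed
  have h6: "((\<lambda>x. b * x powr (b - 1) * G x) has_integral (\<Delta> * f 0 m - b * I - f 1 m * trapezoid_err b j)) S"
    using h5 by (rule has_integral_eq[rotated]) (use eq in auto)
  have h7: "((\<lambda>x. B * (b * x powr (b - 1))) has_integral B * \<Delta>) S"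
    by (intro has_integral_mult_right h1)
  \<comment> \<open>The Taylor remainder is integrated against b x^(b-1), which is integrable even
    at 0 and has integral \<Delta>; these bounds telescope when the cells are added.\<close>
  have "norm (\<Delta> * f 0 m - b * I - f 1 m * trapezoid_err b j) \<le> B * \<Delta>"
  proof (rule has_integral_norm_bound[OF h6 h7])
    show "norm (b * x powr (b - 1) * G x) \<le> B * (b * x powr (b - 1))" if "x \<in> S" for x
      using mult_left_mono[OF G[OF that], of "b * x powr (b - 1)"] b by (simp add: abs_mult mult_ac)
  qed
  then show ?thesis
    unfolding B_def \<Delta>_def I_def S_def m_def f_def by (simp add: mult_ac)
qed

text \<open>On the first cell s^(-a) is unbounded, so only the triangle inequality is available; on
  the others the mean value theorem gives k^(-1-a). The factor 1 + s^(-a) covers both cases and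
  stays integrable.\<close>

lemma midpoint_weight_diff:
  fixes a s :: real and k :: nat
  assumes a: "0 < a" "a < 1" and s: "s \<in> {real k..real k + 1}"
  shows "\<bar>(real k + 1 / 2) powr -a - s powr -a\<bar> \<le> 2 powr (1 + a) * (real k + 1) powr (-1 - a) * (1 + s powr -a)"
proof (cases "k = 0")
  case True
  have "\<bar>(1 / 2) powr -a - s powr -a\<bar> \<le> (1 / 2) powr -a + s powr -a" by (simp add: abs_if)
  also have half: "(1 / 2) powr -a = 2 powr a" by (simp add: powr_divide powr_minus)
  also have "2 powr a + s powr -a \<le> 2 powr (1 + a) * 1 + 2 powr (1 + a) * s powr -a"
    using a mult_right_mono[of 1 "2 powr (1 + a)" "s powr -a"] by (intro add_mono) (auto simp: ge_one_powr_ge_zero)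
  finally show ?thesis using True half by (simp add: algebra_simps)
next
  case False
  have "\<bar>(real k + 1 / 2) powr -a - s powr -a\<bar> \<le> real k powr (-1 - a) * \<bar>real k + 1 / 2 - s\<bar>"
  proof (rule powr_lipschitz_ivl[where l = "real k" and r = "real k + 1"])
    show "\<bar>-a\<bar> * z powr (-a - 1) \<le> real k powr (-1 - a)" if "z \<in> {real k..real k + 1}" for z
    proof -
      have "z powr (-a - 1) \<le> real k powr (-a - 1)" using that False a by (intro powr_mono2') auto
      then have "\<bar>-a\<bar> * z powr (-a - 1) \<le> 1 * real k powr (-a - 1)" using a by (intro mult_mono) auto
      moreover have "-a - 1 = -1 - a" by simp
      ultimately show ?thesis by (simp only: mult_1_left)
    qed
  qed (use False s in auto)
  also have "\<dots> \<le> real k powr (-1 - a) * 1" using s by (intro mult_left_mono) auto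
  \<comment> \<open>For k \<ge> 1 one has k \<ge> (k+1)/2, whence the constant 2^(1+a).\<close>
  also have "\<dots> \<le> ((real k + 1) / 2) powr (-1 - a)"
    using False a by (simp add: powr_mono2')
  also have "\<dots> = 2 powr (1 + a) * (real k + 1) powr (-1 - a) * 1"
    using powr_minus_divide[of 2 "1 + a"] by (simp add: powr_divide)
  also have "\<dots> \<le> 2 powr (1 + a) * (real k + 1) powr (-1 - a) * (1 + s powr -a)"
    by (intro mult_left_mono) auto
  finally show ?thesis .
qed

text \<open>Subadditivity of x^p for p \<le> 1. It bounds the integral of s^(-a) uniformly over all
  cells, the singular first one included.\<close>

lemma powr_Suc_diff_le_1:
  fixes p :: real
  assumes "0 < p" "p \<le> 1"
  shows "(real k + 1) powr p - real k powr p \<le> 1"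
proof (cases "k = 0")
  case False
  have "(real k + 1) powr p = real k * (real k + 1) powr (p - 1) + (real k + 1) powr (p - 1)"
    using powr_mult_base[of "real k + 1" "p - 1"] by (simp add: distrib_right)
  also have "\<dots> \<le> real k * real k powr (p - 1) + 1 powr (p - 1)"
    using assms False by (intro add_mono mult_left_mono powr_mono2') auto
  also have "\<dots> = real k powr p + 1" using False by (simp add: powr_diff)
  finally show ?thesis by simp
qed (use assms in simp)

text \<open>Subtracting the midpoint error with (n - s)^(b-1) frozen at the midpoint leaves the
  integral of a product of two differences, one of the weight and one of the smooth factor. The
  first is summable in k, the second is one power of n smaller. In the constant, 1 + 1/(1-a) bounds
  the integral of 1 + s^(-a) over a cell.\<close>

lemma cell_err_singular_weight:
  fixes a b n :: real and k :: nat
  assumes a: "0 < a" "a < 1" and b: "0 < b" and n: "0 < n" and k: "real k + 1 \<le> 3 / 4 * n"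
    and int: "(\<lambda>s. s powr -a * (n - s) powr (b - 1)) integrable_on {real k..real k + 1}"
  shows "\<bar>(real k + 1 / 2) powr -a * ((n - real k) powr b - (n - (real k + 1)) powr b)
           - b * integral {real k..real k + 1} (\<lambda>s. s powr -a * (n - s) powr (b - 1))
           - b * (n - (real k + 1 / 2)) powr (b - 1) * midpoint_err a k\<bar>
         \<le> (b * \<bar>b - 1\<bar> * 4 powr \<bar>b - 2\<bar> * 2 powr (1 + a) * (1 + 1 / (1 - a))) * n powr (b - 2) * (real k + 1) powr (-1 - a)"
proof -
  define S where "S = {real k..real k + 1}"
  define m where "m = real k + 1 / 2"
  define L where "L = \<bar>b - 1\<bar> * 4 powr \<bar>b - 2\<bar> * n powr (b - 2)"
  define W where "W = 2 powr (1 + a) * (real k + 1) powr (-1 - a)"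
  define \<Delta> where "\<Delta> = ((real k + 1) powr (1 - a) - real k powr (1 - a)) / (1 - a)"
  define I where "I = integral S (\<lambda>s. s powr -a * (n - s) powr (b - 1))"
  have lip: "\<bar>(n - s) powr (b - 1) - (n - m) powr (b - 1)\<bar> \<le> L" if "s \<in> S" for s
  proof -
    have "\<bar>(n - s) powr (b - 1) - (n - m) powr (b - 1)\<bar> \<le> L * \<bar>(n - s) - (n - m)\<bar>"
    proof (rule powr_lipschitz_ivl[where l = "n / 4" and r = n])
      show "\<bar>b - 1\<bar> * z powr (b - 1 - 1) \<le> L" if "z \<in> {n / 4..n}" for z
      proof -
        have "z powr (b - 2) \<le> 4 powr \<bar>b - 2\<bar> * n powr (b - 2)"
          using that n by (intro powr_le_comparable) auto
        then have "\<bar>b - 1\<bar> * z powr (b - 2) \<le> \<bar>b - 1\<bar> * (4 powr \<bar>b - 2\<bar> * n powr (b - 2))"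
          by (intro mult_left_mono) auto
        then show ?thesis by (simp add: L_def mult_ac)
      qed
    qed (use that k n in \<open>auto simp: S_def m_def\<close>)
    also have "\<dots> \<le> L * 1" using that by (intro mult_left_mono) (auto simp: S_def m_def L_def)
    finally show ?thesis by simp
  qed
  have h1: "((\<lambda>s. b * (n - s) powr (b - 1)) has_integral ((n - real k) powr b - (n - (real k + 1)) powr b)) S"
  proof -
    have "((\<lambda>s. b * (n - s) powr (b - 1)) has_integral
            (- ((n - (real k + 1)) powr b) - - ((n - real k) powr b))) {real k..real k + 1}"
    proof (rule fundamental_theorem_of_calculus)
      show "((\<lambda>s. - ((n - s) powr b)) has_vector_derivative b * (n - s) powr (b - 1)) (at s within {real k..real k + 1})"
        if "s \<in> {real k..real k + 1}" for s
        using that n k unfolding has_real_derivative_iff_has_vector_derivative[symmetric]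
        by (auto intro!: derivative_eq_intros)
    qed auto
    then show ?thesis by (simp add: S_def)
  qed
  have h2: "((\<lambda>s. s powr -a * (n - s) powr (b - 1)) has_integral I) S"
    using int unfolding S_def I_def by (rule integrable_integral)
  have h3: "((\<lambda>s. s powr -a) has_integral \<Delta>) S"
  proof -
    have "((\<lambda>s. (1 - a) * s powr (1 - a - 1) / (1 - a)) has_integral \<Delta>) S"
      unfolding \<Delta>_def S_def using a by (intro has_integral_divide has_integral_powr_ivl) auto
    then show ?thesis using a by simp
  qed
  have h4: "((\<lambda>s. 1) has_integral (1::real)) S"
    using has_integral_const_real[of "1::real" "real k" "real k + 1"] by (simp add: S_def)
  have "((\<lambda>s. m powr -a * (b * (n - s) powr (b - 1)) - b * (s powr -a * (n - s) powr (b - 1))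
            - b * (n - m) powr (b - 1) * (m powr -a * 1 - s powr -a))
          has_integral (m powr -a * ((n - real k) powr b - (n - (real k + 1)) powr b) - b * I
            - b * (n - m) powr (b - 1) * (m powr -a * 1 - \<Delta>))) S"
    by (intro has_integral_diff has_integral_mult_right h1 h2 h3 h4)
  then have h5: "((\<lambda>s. b * (m powr -a - s powr -a) * ((n - s) powr (b - 1) - (n - m) powr (b - 1)))
          has_integral (m powr -a * ((n - real k) powr b - (n - (real k + 1)) powr b) - b * I
            - b * (n - m) powr (b - 1) * (m powr -a * 1 - \<Delta>))) S"
    by (rule has_integral_eq[rotated]) (simp add: algebra_simps)
  have h6: "((\<lambda>s. b * W * L * (1 + s powr -a)) has_integral (b * W * L * (1 + \<Delta>))) S"
    by (intro has_integral_mult_right has_integral_add h3 h4)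
  have "norm (m powr -a * ((n - real k) powr b - (n - (real k + 1)) powr b) - b * I
            - b * (n - m) powr (b - 1) * (m powr -a * 1 - \<Delta>)) \<le> b * W * L * (1 + \<Delta>)"
  proof (rule has_integral_norm_bound[OF h5 h6])
    fix s assume s: "s \<in> S"
    have "\<bar>m powr -a - s powr -a\<bar> \<le> W * (1 + s powr -a)"
      using midpoint_weight_diff[of a s k] a s by (simp add: S_def m_def W_def)
    then have "\<bar>m powr -a - s powr -a\<bar> * \<bar>(n - s) powr (b - 1) - (n - m) powr (b - 1)\<bar> \<le> W * (1 + s powr -a) * L"
      using lip[OF s] by (intro mult_mono) (auto simp: W_def)
    then have "b * (\<bar>m powr -a - s powr -a\<bar> * \<bar>(n - s) powr (b - 1) - (n - m) powr (b - 1)\<bar>) \<le> b * (W * (1 + s powr -a) * L)"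
      using b by (intro mult_left_mono) auto
    then show "norm (b * (m powr -a - s powr -a) * ((n - s) powr (b - 1) - (n - m) powr (b - 1)))
       \<le> b * W * L * (1 + s powr -a)"
      using b by (simp add: abs_mult mult_ac)
  qed
  also have "\<dots> \<le> b * W * L * (1 + 1 / (1 - a))"
    using a b powr_Suc_diff_le_1[of "1 - a" k] unfolding \<Delta>_def
    by (intro mult_left_mono add_mono divide_right_mono) (auto simp: W_def L_def)
  also have "\<dots> = (b * \<bar>b - 1\<bar> * 4 powr \<bar>b - 2\<bar> * 2 powr (1 + a) * (1 + 1 / (1 - a))) * n powr (b - 2) * (real k + 1) powr (-1 - a)"
    by (simp add: W_def L_def mult_ac)
  finally show ?thesis
    unfolding I_def S_def m_def \<Delta>_def midpoint_err_def by simp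
qed

subsection \<open>Summing the cell errors\<close>

lemma has_integral_Beta_scaled:
  fixes a b c :: real
  assumes "0 < b" "a < 1" "0 < c"
  shows "((\<lambda>x. x powr (b - 1) * (c - x) powr -a) has_integral c powr (b - a) * Beta b (1 - a)) {0..c}"
proof -
  have "((\<lambda>x. x powr (b - 1) * (1 - x) powr (1 - a - 1)) has_integral Beta b (1 - a)) (cbox 0 1)"
    using has_integral_Beta_real[of b "1 - a"] assms by simp
  from has_integral_affinity[OF this, of "1 / c" 0] assms
  have "((\<lambda>x. (x / c) powr (b - 1) * (1 - x / c) powr -a) has_integral c * Beta b (1 - a)) ((\<lambda>x. c * x) ` {0..1})"
    by (simp add: divide_inverse mult_ac)
  also have "(\<lambda>x. c * x) ` {0..1} = {0..c}"
    using image_mult_atLeastAtMost[of c 0 1] assms by simp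
  finally have scaled: "((\<lambda>x. c powr (b - 1 - a) * ((x / c) powr (b - 1) * (1 - x / c) powr -a)) has_integral
      c powr (b - 1 - a) * (c * Beta b (1 - a))) {0..c}"
    by (rule has_integral_mult_right)
  have value_eq: "c powr (b - 1 - a) * (c * Beta b (1 - a)) = c powr (b - a) * Beta b (1 - a)"
    using powr_mult_base[of c "b - 1 - a"] assms by (simp add: algebra_simps)
  have "c powr (b - 1 - a) * ((x / c) powr (b - 1) * (1 - x / c) powr -a) = x powr (b - 1) * (c - x) powr -a"
    if "x \<in> {0..c}" for x
  proof -
    have "(1 - x / c) powr -a = ((c - x) / c) powr -a" using assms by (simp add: diff_divide_distrib)
    moreover have "c powr (b - 1 - a) = c powr (b - 1) * c powr -a" by (simp flip: powr_add)
    moreover have "c powr (b - 1) > 0" "c powr -a > 0" using assms by auto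
    ultimately show ?thesis using that by (simp add: powr_divide)
  qed
  then show ?thesis using scaled unfolding value_eq by (rule has_integral_eq)
qed

lemma integral_unit_cells:
  fixes f :: "real \<Rightarrow> real"
  assumes "f integrable_on {0..real N}"
  shows "integral {0..real N} f = (\<Sum>j<N. integral {real j..real j + 1} f)"
  using assms
proof (induction N)
  case (Suc N)
  have "f integrable_on {0..real N}"
    by (rule integrable_subinterval_real[OF Suc.prems]) auto
  moreover have "integral {0..real N} f + integral {real N..real (Suc N)} f = integral {0..real (Suc N)} f"
    by (rule Henstock_Kurzweil_Integration.integral_combine[OF _ _ Suc.prems]) auto
  ultimately show ?case using Suc.IH by (simp add: add.commute)
qed simp

lemma integral_reflect_cell:
  fixes f :: "real \<Rightarrow> real"
  shows "integral {c - r..c - l} f = integral {l..r} (\<lambda>s. f (c - s))"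
    and "f integrable_on {c - r..c - l} \<Longrightarrow> (\<lambda>s. f (c - s)) integrable_on {l..r}"
proof -
  have iff: "(f has_integral i) {c - r..c - l} \<longleftrightarrow> ((\<lambda>s. f (c - s)) has_integral i) {l..r}" for i
  proof -
    have im: "(\<lambda>x. c - x) ` {c - r..c - l} = {l..r}" "(\<lambda>x. c - x) ` {l..r} = {c - r..c - l}"
      by (auto simp: image_diff_atLeastAtMost)
    show ?thesis
    proof
      assume "(f has_integral i) {c - r..c - l}"
      then have "(f has_integral i) (cbox (c - r) (c - l))" by simp
      from has_integral_affinity[OF this, of "-1" c] show "((\<lambda>s. f (c - s)) has_integral i) {l..r}"
        using im(1) by (simp add: algebra_simps)
    next
      assume "((\<lambda>s. f (c - s)) has_integral i) {l..r}"
      then have "((\<lambda>s. f (c - s)) has_integral i) (cbox l r)" by simp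
      from has_integral_affinity[OF this, of "-1" c] show "(f has_integral i) {c - r..c - l}"
        using im(2) by (simp add: algebra_simps)
    qed
  qed
  show "integral {c - r..c - l} f = integral {l..r} (\<lambda>s. f (c - s))"
    unfolding integral_def integrable_on_def iff by simp
  show "f integrable_on {c - r..c - l} \<Longrightarrow> (\<lambda>s. f (c - s)) integrable_on {l..r}"
    unfolding integrable_on_def iff by simp
qed

text \<open>Three replacements: each cell error by its trapezoidal term, the coefficient (n -
  x)^(-a-1) at the midpoint by its value at x = 0, and the sum of trapezoidal errors by -zeta(-b).
  The second costs a factor (j+1)/n per cell.\<close>

lemma sum_near_origin:
  assumes a: "0 < a" "a < 1" and b: "0 < b"
  obtains C where "C \<ge> 0" "\<And>n. n \<ge> 2 \<Longrightarrow>
    \<bar>(\<Sum>j<n - n div 2. (real n - (real j + 1 / 2)) powr -a * ((real j + 1) powr b - real j powr b)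
        - b * integral {real j..real j + 1} (\<lambda>x. x powr (b - 1) * (real n - x) powr -a))
      + a * real n powr (-a - 1) * Re (riemann_zeta (of_real (- b)))\<bar> \<le> C * real n powr (b - 2)"
proof -
  define z where "z = Re (riemann_zeta (of_real (- b)))"
  define K where "K = (\<Sum>j. (real j + 1) powr (-1 - a))"
  define d where "d = trapezoid_err b"
  obtain C1 where C1: "C1 \<ge> 0" "\<And>j. \<bar>d j\<bar> \<le> C1 * (real j + 1) powr (b - 2)"
    using trapezoid_err_bound[OF b] unfolding d_def by blast
  obtain C2 where C2: "C2 \<ge> 0" "\<And>N. N \<ge> 1 \<Longrightarrow> \<bar>(\<Sum>j<N. d j) + z\<bar> \<le> C2 * real N powr (b - 1 + a)"
    using trapezoid_err_partial_sum[OF a b] unfolding d_def z_def by blast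
  have K: "K \<ge> 0" unfolding K_def using summable_Suc_powr[OF a(1)] by (intro suminf_nonneg) auto
  define B1 where "B1 = 2 * 4 powr (a + 2)"
  define B2 where "B2 = a * (2 * 4 powr (a + 2))"
  define B3 where "B3 = a * (C2 * 4 powr \<bar>b - 1 + a\<bar>)"
  have "\<bar>(\<Sum>j<n - n div 2. (real n - (real j + 1 / 2)) powr -a * ((real j + 1) powr b - real j powr b)
        - b * integral {real j..real j + 1} (\<lambda>x. x powr (b - 1) * (real n - x) powr -a))
      + a * real n powr (-a - 1) * z\<bar> \<le> (B1 + B2 * C1 * K + B3) * real n powr (b - 2)" if n: "n \<ge> 2" for n
  proof -
    define N where "N = n - n div 2"
    define M where "M = (\<lambda>j. (real n - (real j + 1 / 2)) powr (-a - 1))"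
    define \<epsilon> where "\<epsilon> = (\<lambda>j. (real n - (real j + 1 / 2)) powr -a * ((real j + 1) powr b - real j powr b)
        - b * integral {real j..real j + 1} (\<lambda>x. x powr (b - 1) * (real n - x) powr -a))"
    \<comment> \<open>For odd n this half has (n+1)/2 cells, at most 3n/4 because n \<ge> 2; this is
      the reason for 3/4 in the cell lemmas.\<close>
    have N: "N \<ge> 1" "N \<le> n" "4 * N \<le> 3 * n" "n \<le> 4 * N" using n by (auto simp: N_def)
    have jN: "real j + 1 \<le> 3 / 4 * real n" "real j + 1 \<le> real n" if "j < N" for j
      using that N by linarith+
    have int: "(\<lambda>x. x powr (b - 1) * (real n - x) powr -a) integrable_on {0..real n}"
      using has_integral_Beta_scaled[of b a "real n"] a b n by (auto simp: integrable_on_def)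
    have s1: "\<bar>\<Sum>j<N. \<epsilon> j - a * M j * d j\<bar> \<le> B1 * real n powr (b - 2)"
    proof -
      have "\<bar>\<Sum>j<N. \<epsilon> j - a * M j * d j\<bar> \<le> (\<Sum>j<N. B1 * real n powr (-a - 2) * ((real j + 1) powr b - real j powr b))"
      proof (rule order_trans[OF sum_abs sum_mono])
        fix j assume "j \<in> {..<N}"
        then have j: "j < N" by simp
        have "(\<lambda>x. x powr (b - 1) * (real n - x) powr -a) integrable_on {real j..real j + 1}"
          by (rule integrable_subinterval_real[OF int]) (use jN[OF j] in auto)
        then show "\<bar>\<epsilon> j - a * M j * d j\<bar> \<le> B1 * real n powr (-a - 2) * ((real j + 1) powr b - real j powr b)"
          unfolding \<epsilon>_def M_def d_def B1_def
          using n jN[OF j] by (intro cell_err_smooth_weight a b) auto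
      qed
      also have "\<dots> = B1 * real n powr (-a - 2) * real N powr b"
        unfolding sum_distrib_left[symmetric]
        using sum_lessThan_telescope[of "\<lambda>j. real j powr b" N] b by (simp add: add.commute)
      \<comment> \<open>A factor n^a is given away on purpose: the other half of the interval is
        only controlled up to n^(b-2).\<close>
      also have "\<dots> \<le> B1 * real n powr (-a - 2) * real n powr (b + a)"
      proof -
        have "real N powr b \<le> real n powr b" using N b by (intro powr_mono2) auto
        also have "\<dots> \<le> real n powr (b + a)" using n a by (intro powr_mono) auto
        finally show ?thesis by (intro mult_left_mono) (auto simp: B1_def)
      qed
      also have "\<dots> = B1 * real n powr (b - 2)"
        by (simp add: mult.assoc flip: powr_add)
      finally show ?thesis .
    qed
    have s2: "\<bar>\<Sum>j<N. a * (M j - real n powr (-a - 1)) * d j\<bar> \<le> B2 * C1 * K * real n powr (b - 2)"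
    proof -
      have "\<bar>\<Sum>j<N. a * (M j - real n powr (-a - 1)) * d j\<bar>
          \<le> (\<Sum>j<N. B2 * real n powr (-a - 2) * C1 * (real j + 1) powr (b - 1))"
      proof (rule order_trans[OF sum_abs sum_mono])
        fix j assume "j \<in> {..<N}"
        then have j: "j < N" by simp
        have "\<bar>M j - real n powr (-a - 1)\<bar> \<le> 2 * 4 powr (a + 2) * real n powr (-a - 2) * \<bar>(real n - (real j + 1 / 2)) - real n\<bar>"
          unfolding M_def
        proof (rule powr_lipschitz_ivl[where l = "real n / 4" and r = "real n"])
          show "\<bar>- a - 1\<bar> * y powr (- a - 1 - 1) \<le> 2 * 4 powr (a + 2) * real n powr (- a - 2)"
            if "y \<in> {real n / 4..real n}" for y
          proof -
            have "y powr (- a - 2) \<le> 4 powr \<bar>- a - 2\<bar> * real n powr (- a - 2)"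
              using that n by (intro powr_le_comparable) auto
            moreover have "\<bar>- a - 2\<bar> = a + 2" using a by simp
            ultimately have "\<bar>- a - 1\<bar> * y powr (- a - 2) \<le> 2 * (4 powr (a + 2) * real n powr (- a - 2))"
              using a by (intro mult_mono) auto
            moreover have "- a - 1 - 1 = - a - 2" by simp
            ultimately show ?thesis by (simp only: mult.assoc)
          qed
        qed (use n jN[OF j] in auto)
        also have "\<dots> \<le> 2 * 4 powr (a + 2) * real n powr (-a - 2) * (real j + 1)"
          by (intro mult_left_mono) auto
        finally have "a * \<bar>M j - real n powr (-a - 1)\<bar> * \<bar>d j\<bar>
           \<le> a * (2 * 4 powr (a + 2) * real n powr (-a - 2) * (real j + 1)) * (C1 * (real j + 1) powr (b - 2))"
          using a C1 by (intro mult_mono mult_nonneg_nonneg) auto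
        also have "\<dots> = B2 * real n powr (-a - 2) * C1 * ((real j + 1) * (real j + 1) powr (b - 2))"
          by (simp add: B2_def mult_ac)
        also have "(real j + 1) * (real j + 1) powr (b - 2) = (real j + 1) powr (b - 1)"
          using powr_mult_base[of "real j + 1" "b - 2"] by simp
        finally show "\<bar>a * (M j - real n powr (-a - 1)) * d j\<bar> \<le> B2 * real n powr (-a - 2) * C1 * (real j + 1) powr (b - 1)"
          using a by (simp add: abs_mult)
      qed
      also have "\<dots> \<le> B2 * real n powr (-a - 2) * C1 * (K * real N powr (b - 1 + 1 + a))"
        unfolding sum_distrib_left[symmetric] K_def using a b C1
        by (intro mult_left_mono sum_powr_le) (auto simp: B2_def)
      also have "\<dots> \<le> B2 * real n powr (-a - 2) * C1 * (K * real n powr (b + a))"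
        using N a b C1 K by (intro mult_left_mono) (auto simp: B2_def intro!: powr_mono2)
      also have "\<dots> = B2 * C1 * K * (real n powr (-a - 2) * real n powr (b + a))" by (simp add: mult_ac)
      also have "real n powr (-a - 2) * real n powr (b + a) = real n powr (b - 2)"
        by (simp flip: powr_add)
      finally show ?thesis .
    qed
    have s3: "\<bar>a * real n powr (-a - 1) * ((\<Sum>j<N. d j) + z)\<bar> \<le> B3 * real n powr (b - 2)"
    proof -
      have "\<bar>(\<Sum>j<N. d j) + z\<bar> \<le> C2 * real N powr (b - 1 + a)" by (rule C2(2)[OF N(1)])
      also have "\<dots> \<le> C2 * (4 powr \<bar>b - 1 + a\<bar> * real n powr (b - 1 + a))"
        using N n by (intro mult_left_mono C2 powr_le_comparable) auto
      finally have "a * real n powr (-a - 1) * \<bar>(\<Sum>j<N. d j) + z\<bar> \<le>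
         a * real n powr (-a - 1) * (C2 * (4 powr \<bar>b - 1 + a\<bar> * real n powr (b - 1 + a)))"
        using a by (intro mult_left_mono) auto
      also have "\<dots> = B3 * (real n powr (-a - 1) * real n powr (b - 1 + a))" by (simp add: B3_def mult_ac)
      also have "real n powr (-a - 1) * real n powr (b - 1 + a) = real n powr (b - 2)"
        by (simp flip: powr_add)
      finally show ?thesis using a by (simp add: abs_mult)
    qed
    have "(\<Sum>j<N. \<epsilon> j) + a * real n powr (-a - 1) * z =
       (\<Sum>j<N. \<epsilon> j - a * M j * d j) + (\<Sum>j<N. a * (M j - real n powr (-a - 1)) * d j)
       + a * real n powr (-a - 1) * ((\<Sum>j<N. d j) + z)"
      by (simp add: algebra_simps sum_subtractf sum_distrib_left sum_distrib_right)
    then have "\<bar>(\<Sum>j<N. \<epsilon> j) + a * real n powr (-a - 1) * z\<bar> \<le>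
      B1 * real n powr (b - 2) + B2 * C1 * K * real n powr (b - 2) + B3 * real n powr (b - 2)"
      using s1 s2 s3 by linarith
    then show ?thesis unfolding N_def \<epsilon>_def by (simp add: algebra_simps)
  qed
  moreover have "B1 + B2 * C1 * K + B3 \<ge> 0"
    using a C1 C2 K by (simp add: B1_def B2_def B3_def)
  ultimately show ?thesis using that unfolding z_def by blast
qed

text \<open>The same three replacements at the other end, with midpoint errors. All three parts are
  bounded by n^(b-2) because the k-sums are bounded by the convergent series
  \<open>K\<close>.\<close>

lemma sum_near_endpoint:
  assumes a: "0 < a" "a < 1" and b: "0 < b"
  obtains C where "C \<ge> 0" "\<And>n. n \<ge> 2 \<Longrightarrow>
    \<bar>(\<Sum>k<n div 2. (real k + 1 / 2) powr -a * ((real n - real k) powr b - (real n - (real k + 1)) powr b)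
        - b * integral {real k..real k + 1} (\<lambda>s. s powr -a * (real n - s) powr (b - 1)))
      - b * real n powr (b - 1) * ((2 powr a - 1) * Re (riemann_zeta (of_real a)))\<bar> \<le> C * real n powr (b - 2)"
proof -
  define z where "z = (2 powr a - 1) * Re (riemann_zeta (of_real a))"
  define K where "K = (\<Sum>j. (real j + 1) powr (-1 - a))"
  define v where "v = midpoint_err a"
  obtain C1 where C1: "C1 \<ge> 0" "\<And>k. \<bar>v k\<bar> \<le> C1 * (real k + 1) powr (-a - 2)"
    using midpoint_err_bound[OF a] unfolding v_def by blast
  have K: "K \<ge> 0" unfolding K_def using summable_Suc_powr[OF a(1)] by (intro suminf_nonneg) auto
  have sumK: "(\<Sum>k<N. (real k + 1) powr (-1 - a)) \<le> K" for N
    unfolding K_def using summable_Suc_powr[OF a(1)] by (intro sum_le_suminf) auto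
  define L where "L = \<bar>b - 1\<bar> * 4 powr \<bar>b - 2\<bar>"
  define B1 where "B1 = b * \<bar>b - 1\<bar> * 4 powr \<bar>b - 2\<bar> * 2 powr (1 + a) * (1 + 1 / (1 - a))"
  have B1: "B1 \<ge> 0" using a b by (simp add: B1_def)
  have "\<bar>(\<Sum>k<n div 2. (real k + 1 / 2) powr -a * ((real n - real k) powr b - (real n - (real k + 1)) powr b)
        - b * integral {real k..real k + 1} (\<lambda>s. s powr -a * (real n - s) powr (b - 1)))
      - b * real n powr (b - 1) * z\<bar> \<le> (B1 * K + b * L * C1 * K + 2 * b * C1 * K) * real n powr (b - 2)" if n: "n \<ge> 2" for n
  proof -
    define N where "N = n div 2"
    define P where "P = (\<lambda>k. (real n - (real k + 1 / 2)) powr (b - 1))"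
    define \<epsilon> where "\<epsilon> = (\<lambda>k. (real k + 1 / 2) powr -a * ((real n - real k) powr b - (real n - (real k + 1)) powr b)
        - b * integral {real k..real k + 1} (\<lambda>s. s powr -a * (real n - s) powr (b - 1)))"
    have N: "2 * N \<le> n" "n \<le> 2 * (N + 1)" using n by (auto simp: N_def)
    have kN: "real k + 1 \<le> 3 / 4 * real n" "real k + 1 \<le> real n" if "k < N" for k
      using that N by linarith+
    have int: "(\<lambda>x. x powr (b - 1) * (real n - x) powr -a) integrable_on {0..real n}"
      using has_integral_Beta_scaled[of b a "real n"] a b n by (auto simp: integrable_on_def)
    have s1: "\<bar>\<Sum>k<N. \<epsilon> k - b * P k * v k\<bar> \<le> B1 * K * real n powr (b - 2)"
    proof -
      have "\<bar>\<Sum>k<N. \<epsilon> k - b * P k * v k\<bar> \<le> (\<Sum>k<N. B1 * real n powr (b - 2) * (real k + 1) powr (-1 - a))"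
      proof (rule order_trans[OF sum_abs sum_mono])
        fix k assume "k \<in> {..<N}"
        then have k: "k < N" by simp
        have "(\<lambda>x. x powr (b - 1) * (real n - x) powr -a) integrable_on {real n - (real k + 1)..real n - real k}"
          by (rule integrable_subinterval_real[OF int]) (use kN[OF k] in auto)
        from integral_reflect_cell(2)[OF this]
        have "(\<lambda>s. s powr -a * (real n - s) powr (b - 1)) integrable_on {real k..real k + 1}"
          by (simp add: mult.commute)
        then show "\<bar>\<epsilon> k - b * P k * v k\<bar> \<le> B1 * real n powr (b - 2) * (real k + 1) powr (-1 - a)"
          unfolding \<epsilon>_def P_def v_def B1_def
          using n kN[OF k] by (intro cell_err_singular_weight a b) auto
      qed
      also have "\<dots> \<le> B1 * real n powr (b - 2) * K"
        unfolding sum_distrib_left[symmetric] using B1 by (intro mult_left_mono sumK) auto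
      finally show ?thesis by (simp add: mult_ac)
    qed
    have s2: "\<bar>\<Sum>k<N. b * (P k - real n powr (b - 1)) * v k\<bar> \<le> b * L * C1 * K * real n powr (b - 2)"
    proof -
      have "\<bar>\<Sum>k<N. b * (P k - real n powr (b - 1)) * v k\<bar>
          \<le> (\<Sum>k<N. b * L * real n powr (b - 2) * C1 * (real k + 1) powr (-1 - a))"
      proof (rule order_trans[OF sum_abs sum_mono])
        fix k assume "k \<in> {..<N}"
        then have k: "k < N" by simp
        have "\<bar>P k - real n powr (b - 1)\<bar> \<le> L * real n powr (b - 2) * \<bar>(real n - (real k + 1 / 2)) - real n\<bar>"
          unfolding P_def
        proof (rule powr_lipschitz_ivl[where l = "real n / 4" and r = "real n"])
          show "\<bar>b - 1\<bar> * y powr (b - 1 - 1) \<le> L * real n powr (b - 2)"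
            if "y \<in> {real n / 4..real n}" for y
          proof -
            have "y powr (b - 2) \<le> 4 powr \<bar>b - 2\<bar> * real n powr (b - 2)"
              using that n by (intro powr_le_comparable) auto
            then have "\<bar>b - 1\<bar> * y powr (b - 2) \<le> \<bar>b - 1\<bar> * (4 powr \<bar>b - 2\<bar> * real n powr (b - 2))"
              by (intro mult_left_mono) auto
            then show ?thesis by (simp add: L_def mult_ac)
          qed
        qed (use n kN[OF k] in auto)
        also have "\<dots> \<le> L * real n powr (b - 2) * (real k + 1)"
          by (intro mult_left_mono) (auto simp: L_def)
        finally have "b * \<bar>P k - real n powr (b - 1)\<bar> * \<bar>v k\<bar>
           \<le> b * (L * real n powr (b - 2) * (real k + 1)) * (C1 * (real k + 1) powr (-a - 2))"
          using b C1 by (intro mult_mono mult_nonneg_nonneg) (auto simp: L_def)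
        also have "\<dots> = b * L * real n powr (b - 2) * C1 * ((real k + 1) * (real k + 1) powr (-a - 2))"
          by (simp add: mult_ac)
        also have "(real k + 1) * (real k + 1) powr (-a - 2) = (real k + 1) powr (-1 - a)"
          using powr_mult_base[of "real k + 1" "-a - 2"] by (simp add: algebra_simps)
        finally show "\<bar>b * (P k - real n powr (b - 1)) * v k\<bar> \<le> b * L * real n powr (b - 2) * C1 * (real k + 1) powr (-1 - a)"
          using b by (simp add: abs_mult)
      qed
      also have "\<dots> \<le> b * L * real n powr (b - 2) * C1 * K"
        unfolding sum_distrib_left[symmetric] using b C1 by (intro mult_left_mono sumK) (auto simp: L_def)
      finally show ?thesis by (simp add: mult_ac)
    qed
    have s3: "\<bar>b * real n powr (b - 1) * ((\<Sum>k<N. v k) - z)\<bar> \<le> 2 * b * C1 * K * real n powr (b - 2)"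
    proof -
      have "\<bar>(\<Sum>k<N. v k) - z\<bar> \<le> C1 * K * (real N + 1) powr (-a - 2 + 1 + a)"
        unfolding K_def by (rule sums_powr_tail[OF a(1) _ C1(2)])
          (use midpoint_err_sums[OF a] in \<open>auto simp: v_def z_def\<close>)
      \<comment> \<open>With p = -a - 2 the tail exponent p + 1 + a is -1, so the tail of the
        midpoint errors supplies exactly the missing power of n.\<close>
      also have "(real N + 1) powr (-a - 2 + 1 + a) = 1 / (real N + 1)"
        by (simp add: powr_minus_divide)
      also have "1 / (real N + 1) \<le> 2 / real n" using N n by (simp add: field_simps)
      finally have "\<bar>(\<Sum>k<N. v k) - z\<bar> \<le> C1 * K * (2 / real n)"
        using C1 K by (simp add: mult_left_mono)
      then have "b * real n powr (b - 1) * \<bar>(\<Sum>k<N. v k) - z\<bar> \<le> b * real n powr (b - 1) * (C1 * K * (2 / real n))"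
        using b by (intro mult_left_mono) auto
      also have "\<dots> = 2 * b * C1 * K * (real n powr (b - 1) / real n)" by simp
      also have "real n powr (b - 1) / real n = real n powr (b - 2)"
        using n powr_diff[of "real n" "b - 1" 1] by simp
      finally show ?thesis using b by (simp add: abs_mult)
    qed
    have "(\<Sum>k<N. \<epsilon> k) - b * real n powr (b - 1) * z =
       (\<Sum>k<N. \<epsilon> k - b * P k * v k) + (\<Sum>k<N. b * (P k - real n powr (b - 1)) * v k)
       + b * real n powr (b - 1) * ((\<Sum>k<N. v k) - z)"
      by (simp add: algebra_simps sum_subtractf sum_distrib_left sum_distrib_right)
    then have "\<bar>(\<Sum>k<N. \<epsilon> k) - b * real n powr (b - 1) * z\<bar> \<le>
      B1 * K * real n powr (b - 2) + b * L * C1 * K * real n powr (b - 2) + 2 * b * C1 * K * real n powr (b - 2)"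
      using s1 s2 s3 by linarith
    then show ?thesis unfolding N_def \<epsilon>_def by (simp add: algebra_simps)
  qed
  moreover have "B1 * K + b * L * C1 * K + 2 * b * C1 * K \<ge> 0"
    using b C1 K B1 by (simp add: L_def)
  ultimately show ?thesis using that unfolding z_def by blast
qed

text \<open>Cell k counted from s = 0 is cell n - 1 - k counted from x = 0. The first n div 2 cells
  are treated in the variable s, the rest in x = n - s.\<close>

lemma midpoint_sum_asymptotics:
  assumes a: "0 < a" "a < 1" and b: "0 < b"
  obtains C where "C \<ge> 0" "\<And>n. n \<ge> 2 \<Longrightarrow>
    \<bar>(\<Sum>k<n. (real k + 1 / 2) powr -a * (real (n - k) powr b - real (n - Suc k) powr b))
      - (b * integral {0..real n} (\<lambda>x. x powr (b - 1) * (real n - x) powr -a)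
         + b * real n powr (b - 1) * ((2 powr a - 1) * Re (riemann_zeta (of_real a)))
         - a * real n powr (-a - 1) * Re (riemann_zeta (of_real (- b))))\<bar> \<le> C * real n powr (b - 2)"
proof -
  define z1 where "z1 = (2 powr a - 1) * Re (riemann_zeta (of_real a))"
  define z2 where "z2 = Re (riemann_zeta (of_real (- b)))"
  define J where "J = (\<lambda>n x. x powr (b - 1) * (real n - x) powr -a)"
  define R where "R = (\<lambda>n j. (real n - (real j + 1 / 2)) powr -a * ((real j + 1) powr b - real j powr b)
        - b * integral {real j..real j + 1} (J n))"
  define L where "L = (\<lambda>n k. (real k + 1 / 2) powr -a * ((real n - real k) powr b - (real n - (real k + 1)) powr b)
        - b * integral {real k..real k + 1} (\<lambda>s. s powr -a * (real n - s) powr (b - 1)))"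
  obtain C1 where C1: "C1 \<ge> 0" "\<And>n. n \<ge> 2 \<Longrightarrow>
    \<bar>(\<Sum>j<n - n div 2. R n j) + a * real n powr (-a - 1) * z2\<bar> \<le> C1 * real n powr (b - 2)"
    using sum_near_origin[OF a b, folded z2_def] unfolding R_def J_def by blast
  obtain C2 where C2: "C2 \<ge> 0" "\<And>n. n \<ge> 2 \<Longrightarrow>
    \<bar>(\<Sum>k<n div 2. L n k) - b * real n powr (b - 1) * z1\<bar> \<le> C2 * real n powr (b - 2)"
    using sum_near_endpoint[OF a b, folded z1_def] unfolding L_def by blast
  have "\<bar>(\<Sum>k<n. (real k + 1 / 2) powr -a * (real (n - k) powr b - real (n - Suc k) powr b))
      - (b * integral {0..real n} (J n) + b * real n powr (b - 1) * z1 - a * real n powr (-a - 1) * z2)\<bar>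
      \<le> (C1 + C2) * real n powr (b - 2)" if n: "n \<ge> 2" for n
  proof -
    define E where "E = (\<lambda>k. (real k + 1 / 2) powr -a * (real (n - k) powr b - real (n - Suc k) powr b))"
    define I where "I = (\<lambda>j. integral {real j..real j + 1} (J n))"
    define M where "M = n div 2"
    have M: "M \<le> n" by (simp add: M_def)
    have int: "J n integrable_on {0..real n}"
      using has_integral_Beta_scaled[of b a "real n"] a b n unfolding J_def by (auto simp: integrable_on_def)
    have I: "integral {0..real n} (J n) = (\<Sum>j<n. I j)"
      unfolding I_def by (rule integral_unit_cells[OF int])
    have L: "L n k = E k - b * I (n - Suc k)" if "k < M" for k
    proof -
      have k: "real (n - Suc k) = real n - (real k + 1)" "real (n - k) = real n - real k"
        using that M by (auto simp: of_nat_diff)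
      have "integral {real n - (real k + 1)..real n - real k} (J n) =
          integral {real k..real k + 1} (\<lambda>s. s powr -a * (real n - s) powr (b - 1))"
        unfolding integral_reflect_cell(1) by (simp add: J_def mult.commute)
      moreover have "real n - (real k + 1) + 1 = real n - real k" by simp
      ultimately show ?thesis unfolding L_def E_def I_def k by (simp only:)
    qed
    have R: "R n j = E (n - Suc j) - b * I j" if "j < n - M" for j
    proof -
      have j: "real (n - Suc j) + 1 / 2 = real n - (real j + 1 / 2)" "n - (n - Suc j) = Suc j" "n - Suc (n - Suc j) = j"
        using that by (auto simp: of_nat_diff)
      show ?thesis unfolding R_def E_def I_def j by (simp add: add.commute)
    qed
    have split: "(\<Sum>k<n. f k) = (\<Sum>k<m. f k) + (\<Sum>j<n - m. f (n - Suc j))" if "m \<le> n" for f :: "nat \<Rightarrow> real" and m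
    proof -
      have "(\<Sum>k<n. f k) = (\<Sum>k<m. f k) + (\<Sum>k\<in>{m..<n}. f k)"
        using that sum.atLeastLessThan_concat[of 0 m n f] by (simp add: atLeast0LessThan)
      also have "(\<Sum>k\<in>{m..<n}. f k) = (\<Sum>j<n - m. f (n - Suc j))"
        by (rule sum.reindex_bij_witness[where i = "\<lambda>j. n - Suc j" and j = "\<lambda>k. n - Suc k"]) auto
      finally show ?thesis .
    qed
    have "(\<Sum>k<n. E k) = (\<Sum>k<M. E k) + (\<Sum>j<n - M. E (n - Suc j))"
      using M by (rule split)
    \<comment> \<open>The integrals are indexed from x = 0, so they are cut at n - M where the sum
      \<open>E\<close> is cut at M.\<close>
    moreover have "(\<Sum>j<n. I j) = (\<Sum>j<n - M. I j) + (\<Sum>k<M. I (n - Suc k))"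
      using split[of "n - M" I] M by simp
    moreover have "(\<Sum>k<M. L n k) = (\<Sum>k<M. E k) - b * (\<Sum>k<M. I (n - Suc k))"
      using L by (simp add: sum_subtractf sum_distrib_left)
    moreover have "(\<Sum>j<n - M. R n j) = (\<Sum>j<n - M. E (n - Suc j)) - b * (\<Sum>j<n - M. I j)"
      using R by (simp add: sum_subtractf sum_distrib_left)
    ultimately have "(\<Sum>k<n. E k) - (b * integral {0..real n} (J n) + b * real n powr (b - 1) * z1 - a * real n powr (-a - 1) * z2)
      = ((\<Sum>j<n - M. R n j) + a * real n powr (-a - 1) * z2) + ((\<Sum>k<M. L n k) - b * real n powr (b - 1) * z1)"
      unfolding I by (simp add: algebra_simps)
    then have "\<bar>(\<Sum>k<n. E k) - (b * integral {0..real n} (J n) + b * real n powr (b - 1) * z1 - a * real n powr (-a - 1) * z2)\<bar>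
      \<le> (C1 + C2) * real n powr (b - 2)"
      using C1(2)[OF n] C2(2)[OF n] unfolding M_def distrib_right by linarith
    then show ?thesis by (simp only: E_def)
  qed
  then show ?thesis using that[of "C1 + C2"] C1(1) C2(1) unfolding J_def z1_def z2_def by simp
qed

section \<open>Caputo derivative of a power, summation by parts, assembly\<close>

text \<open>The value stays in Beta form, because the integral in the midpoint asymptotics gives the
  same Beta value and the two cancel without passing to Gamma quotients.\<close>

lemma caputo_deriv_powr:
  assumes a: "0 < \<alpha>" "\<alpha> < 1" and b: "\<beta> > 0" and t: "t > 0"
    and y: "\<And>x. x \<ge> 0 \<Longrightarrow> y x = x powr \<beta>"
  shows "deriv y t = \<beta> * t powr (\<beta> - 1)"
    and "caputo_deriv \<alpha> y t = \<beta> * t powr (\<beta> - \<alpha>) * Beta \<beta> (1 - \<alpha>) / Gamma (1 - \<alpha>)"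
proof -
  have d: "deriv y x = \<beta> * x powr (\<beta> - 1)" if "x > 0" for x
  proof (rule DERIV_imp_deriv)
    have "((\<lambda>x. x powr \<beta>) has_field_derivative \<beta> * x powr (\<beta> - 1)) (at x)"
      using that by (auto intro!: derivative_eq_intros)
    then show "(y has_field_derivative \<beta> * x powr (\<beta> - 1)) (at x)"
      by (rule has_field_derivative_transform_within_open[where S = "{0<..}"]) (use that y in auto)
  qed
  then show "deriv y t = \<beta> * t powr (\<beta> - 1)" using t by blast
  have "((\<lambda>x. \<beta> * (x powr (\<beta> - 1) * (t - x) powr -\<alpha>)) has_integral \<beta> * (t powr (\<beta> - \<alpha>) * Beta \<beta> (1 - \<alpha>))) {0..t}"
    using has_integral_Beta_scaled[of \<beta> \<alpha> t] a b t by (intro has_integral_mult_right) auto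
  then have "((\<lambda>x. deriv y x / (t - x) powr \<alpha>) has_integral \<beta> * (t powr (\<beta> - \<alpha>) * Beta \<beta> (1 - \<alpha>))) {0..t}"
    \<comment> \<open>\<open>y\<close> is prescribed only for x \<ge> 0, so \<open>deriv y 0\<close>
      is undetermined; a single point does not affect the integral.\<close>
    by (rule has_integral_spike_finite[where S = "{0}", rotated 2])
       (auto simp: d powr_minus field_simps)
  then show "caputo_deriv \<alpha> y t = \<beta> * t powr (\<beta> - \<alpha>) * Beta \<beta> (1 - \<alpha>) / Gamma (1 - \<alpha>)"
    unfolding caputo_deriv_def by (simp add: integral_unique)
qed

text \<open>Since 2^a / (2k+1)^a = (k + 1/2)^(-a), the coefficients are differences of midpoint
  weights; moving the difference onto \<open>Y\<close> produces the increments of y over the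
  cells.\<close>

lemma fractional_sum_by_parts:
  fixes Y :: "nat \<Rightarrow> real"
  assumes n: "n \<ge> 1" and Y: "Y 0 = 0"
  shows "2 powr a * ((\<Sum>k=1..n - 1. (1 / (2 * real k + 1) powr a - 1 / (2 * real k - 1) powr a) * Y (n - k)) + Y n)
           = (\<Sum>k<n. (real k + 1 / 2) powr -a * (Y (n - k) - Y (n - Suc k)))"
proof -
  define c where "c = (\<lambda>k. (real k + 1 / 2) powr -a)"
  have c: "2 powr a * (1 / (2 * real k + 1) powr a) = c k" for k
  proof -
    have "real k + 1 / 2 = (2 * real k + 1) / 2" by simp
    then show ?thesis unfolding c_def by (simp only: powr_divide) (simp add: powr_divide powr_minus field_simps)
  qed
  have c': "2 powr a * (1 / (2 * real k - 1) powr a) = c (k - 1)" if "k \<ge> 1" for k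
    using c[of "k - 1"] that by (simp add: of_nat_diff algebra_simps)
  have diff: "2 powr a * (1 / (2 * real k + 1) powr a - 1 / (2 * real k - 1) powr a) = c k - c (k - 1)" if "k \<ge> 1" for k
    unfolding right_diff_distrib c c'[OF that] ..
  have c0: "2 powr a = c 0" using c[of 0] by simp
  have "2 powr a * ((\<Sum>k=1..n - 1. (1 / (2 * real k + 1) powr a - 1 / (2 * real k - 1) powr a) * Y (n - k)) + Y n)
      = (\<Sum>k=1..n - 1. (c k - c (k - 1)) * Y (n - k)) + c 0 * Y n"
    unfolding distrib_left sum_distrib_left mult.assoc[symmetric] c0[symmetric]
    by (intro arg_cong2[where f = "(+)"] sum.cong refl) (simp only: diff atLeastAtMost_iff)
  also have "\<dots> = (\<Sum>k<n. c k * (Y (n - k) - Y (n - Suc k)))"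
  proof -
    obtain m where m: "n = Suc m" using n by (cases n) auto
    have "(\<Sum>k=1..m. c k * Y (n - k)) + c 0 * Y n = (\<Sum>k<Suc m. c k * Y (n - k))"
      by (simp add: sum.lessThan_Suc_shift sum.atLeast1_atMost_eq del: sum.lessThan_Suc)
    \<comment> \<open>After the shift the right-hand sum has one additional term, at k = m, which
      vanishes because \<open>Y 0 = 0\<close>.\<close>
    moreover have "(\<Sum>k=1..m. c (k - 1) * Y (n - k)) = (\<Sum>k<Suc m. c k * Y (n - Suc k))"
      using Y m by (simp add: sum.atLeast1_atMost_eq)
    ultimately show ?thesis using m by (simp add: left_diff_distrib right_diff_distrib sum_subtractf del: sum.lessThan_Suc)
  qed
  finally show ?thesis unfolding c_def .
qed

theorem claim8:
  fixes \<alpha> \<beta> t :: real and y :: "real \<Rightarrow> real" and h :: "nat \<Rightarrow> real"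
  assumes "0 < \<alpha>" and "\<alpha> < 1" and "\<beta> > 0" and "t > 0"
    and y: "\<And>x. x \<ge> 0 \<Longrightarrow> y x = x powr \<beta>"
    and h: "\<And>n. n \<ge> 2 \<Longrightarrow> h n = t / real n"
  shows "(\<lambda>n.
      2 powr \<alpha> / (Gamma (1 - \<alpha>) * h n powr \<alpha>) *
        ((\<Sum>k = 1..n - 1. (1 / (2 * real k + 1) powr \<alpha> - 1 / (2 * real k - 1) powr \<alpha>) *
             y (real (n - k) * h n)) + y (real n * h n))
      - (caputo_deriv \<alpha> y t
         + (2 powr \<alpha> - 1) / Gamma (1 - \<alpha>) * Re (riemann_zeta (complex_of_real \<alpha>)) *
             deriv y t * h n powr (1 - \<alpha>)
         + Re (riemann_zeta (complex_of_real (- \<beta>))) / (Gamma (- \<alpha>) * t powr (1 + \<alpha>)) *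
             h n powr (1 + \<beta>)))
    \<in> O[at_top](\<lambda>n. h n powr (2 - \<alpha>))"
proof -
  define z1 where "z1 = Re (riemann_zeta (complex_of_real \<alpha>))"
  define z2 where "z2 = Re (riemann_zeta (complex_of_real (- \<beta>)))"
  define \<Gamma> where "\<Gamma> = Gamma (1 - \<alpha>)"
  define B where "B = Beta \<beta> (1 - \<alpha>)"
  define S where "S = (\<lambda>n. \<Sum>k<n. (real k + 1 / 2) powr -\<alpha> * (real (n - k) powr \<beta> - real (n - Suc k) powr \<beta>))"
  define A where "A = (\<lambda>n. \<beta> * (real n powr (\<beta> - \<alpha>) * B) + \<beta> * real n powr (\<beta> - 1) * ((2 powr \<alpha> - 1) * z1)
         - \<alpha> * real n powr (-\<alpha> - 1) * z2)"
  have \<Gamma>: "\<Gamma> > 0" using assms by (simp add: \<Gamma>_def Gamma_real_pos)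
  \<comment> \<open>The functional equation at -\<alpha>; it turns the coefficient -\<alpha> /
    Gamma(1-\<alpha>) of zeta(-\<beta>) into 1 / Gamma(-\<alpha>).\<close>
  have G': "Gamma (- \<alpha>) = - (\<Gamma> / \<alpha>)"
  proof -
    have "- \<alpha> \<notin> \<int>"
    proof
      assume "- \<alpha> \<in> \<int>"
      then obtain k where "- \<alpha> = of_int k" by (elim Ints_cases)
      then have "-1 < k" "k < 0" using assms(1,2) by linarith+
      then show False by simp
    qed
    then have "- \<alpha> \<notin> \<int>\<^sub>\<le>\<^sub>0" using nonpos_Ints_subset_Ints by blast
    then have "Gamma (1 - \<alpha>) = - \<alpha> * Gamma (- \<alpha>)"
      using Gamma_plus1[of "- \<alpha>"] by simp
    then show ?thesis using assms(1) by (simp add: \<Gamma>_def)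
  qed
  have deriv: "deriv y t = \<beta> * t powr (\<beta> - 1)"
    by (rule caputo_deriv_powr(1)[OF assms(1-4)]) (rule y)
  have caputo: "caputo_deriv \<alpha> y t = \<beta> * t powr (\<beta> - \<alpha>) * B / \<Gamma>"
    unfolding B_def \<Gamma>_def by (rule caputo_deriv_powr(2)[OF assms(1-4)]) (rule y)
  obtain C where C_int: "\<And>n. n \<ge> 2 \<Longrightarrow>
    \<bar>S n - (\<beta> * integral {0..real n} (\<lambda>x. x powr (\<beta> - 1) * (real n - x) powr -\<alpha>)
         + \<beta> * real n powr (\<beta> - 1) * ((2 powr \<alpha> - 1) * z1) - \<alpha> * real n powr (-\<alpha> - 1) * z2)\<bar>
      \<le> C * real n powr (\<beta> - 2)"
    using midpoint_sum_asymptotics[OF assms(1-3), folded z1_def z2_def] unfolding S_def by blast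
  have C: "\<bar>S n - A n\<bar> \<le> C * real n powr (\<beta> - 2)" if "n \<ge> 2" for n
  proof -
    have "integral {0..real n} (\<lambda>x. x powr (\<beta> - 1) * (real n - x) powr -\<alpha>) = real n powr (\<beta> - \<alpha>) * B"
      using has_integral_Beta_scaled[of \<beta> \<alpha> "real n"] assms that by (simp add: integral_unique B_def)
    then show ?thesis using C_int[OF that] unfolding A_def by (simp only:)
  qed
  have "norm (2 powr \<alpha> / (\<Gamma> * h n powr \<alpha>) *
        ((\<Sum>k = 1..n - 1. (1 / (2 * real k + 1) powr \<alpha> - 1 / (2 * real k - 1) powr \<alpha>) *
             y (real (n - k) * h n)) + y (real n * h n))
      - (caputo_deriv \<alpha> y t + (2 powr \<alpha> - 1) / \<Gamma> * z1 * deriv y t * h n powr (1 - \<alpha>)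
         + z2 / (Gamma (- \<alpha>) * t powr (1 + \<alpha>)) * h n powr (1 + \<beta>)))
     \<le> (C * t powr (\<beta> - 2) / \<Gamma>) * norm (h n powr (2 - \<alpha>))" if n: "n \<ge> 2" for n
  proof -
    define H where "H = h n"
    have H: "H > 0" "t = real n * H" using h[OF n] assms n by (auto simp: H_def)
    \<comment> \<open>Writing t = nH lets every term be expressed as H^(\<beta> - \<alpha>) /
      \<Gamma> times a quantity that depends on n alone.\<close>
    have tp: "t powr p = real n powr p * H powr p" for p using H by (simp add: powr_mult)
    have n0: "real n > 0" using n by simp
    have main: "2 powr \<alpha> / (\<Gamma> * H powr \<alpha>) *
        ((\<Sum>k = 1..n - 1. (1 / (2 * real k + 1) powr \<alpha> - 1 / (2 * real k - 1) powr \<alpha>) *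
             y (real (n - k) * H)) + y (real n * H)) = H powr (\<beta> - \<alpha>) / \<Gamma> * S n"
    proof -
      have yk: "y (real k * H) = H powr \<beta> * real k powr \<beta>" for k
        using y[of "real k * H"] H by (simp add: powr_mult mult.commute)
      have "2 powr \<alpha> * ((\<Sum>k = 1..n - 1. (1 / (2 * real k + 1) powr \<alpha> - 1 / (2 * real k - 1) powr \<alpha>) *
             y (real (n - k) * H)) + y (real n * H))
          = (\<Sum>k<n. (real k + 1 / 2) powr -\<alpha> * (y (real (n - k) * H) - y (real (n - Suc k) * H)))"
        by (rule fractional_sum_by_parts) (use n y[of 0] assms(3) in auto)
      also have "\<dots> = H powr \<beta> * S n"
        unfolding yk S_def sum_distrib_left
        by (intro sum.cong refl) (simp only: right_diff_distrib mult.left_commute)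
      finally have "2 powr \<alpha> * ((\<Sum>k = 1..n - 1. (1 / (2 * real k + 1) powr \<alpha> - 1 / (2 * real k - 1) powr \<alpha>) *
             y (real (n - k) * H)) + y (real n * H)) = H powr \<beta> * S n" .
      moreover have "2 powr \<alpha> / (\<Gamma> * H powr \<alpha>) * X = 2 powr \<alpha> * X / (\<Gamma> * H powr \<alpha>)" for X by simp
      moreover have "H powr \<beta> * S n / (\<Gamma> * H powr \<alpha>) = H powr (\<beta> - \<alpha>) / \<Gamma> * S n"
        by (simp add: powr_diff)
      ultimately show ?thesis by (simp only:)
    qed
    have c: "caputo_deriv \<alpha> y t = H powr (\<beta> - \<alpha>) / \<Gamma> * (\<beta> * (real n powr (\<beta> - \<alpha>) * B))"
      unfolding caputo tp by simp
    have z1: "(2 powr \<alpha> - 1) / \<Gamma> * z1 * deriv y t * H powr (1 - \<alpha>) =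
        H powr (\<beta> - \<alpha>) / \<Gamma> * (\<beta> * real n powr (\<beta> - 1) * ((2 powr \<alpha> - 1) * z1))"
    proof -
      have "H powr (\<beta> - \<alpha>) = H powr (\<beta> - 1) * H powr (1 - \<alpha>)" by (simp flip: powr_add)
      then show ?thesis unfolding deriv tp by simp
    qed
    have z2: "z2 / (Gamma (- \<alpha>) * t powr (1 + \<alpha>)) * H powr (1 + \<beta>) =
        H powr (\<beta> - \<alpha>) / \<Gamma> * (- (\<alpha> * real n powr (-\<alpha> - 1) * z2))"
    proof -
      have "H powr (1 + \<beta>) = H powr (\<beta> - \<alpha>) * H powr (1 + \<alpha>)"
        by (simp add: add.commute flip: powr_add)
      moreover have "real n powr (-\<alpha> - 1) = 1 / real n powr (1 + \<alpha>)"
      proof -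
        have "-\<alpha> - 1 = - (1 + \<alpha>)" by simp
        then show ?thesis by (simp only: powr_minus_divide)
      qed
      moreover have "H powr (1 + \<alpha>) > 0" "real n powr (1 + \<alpha>) > 0" using H n0 by auto
      ultimately show ?thesis unfolding G' tp using \<Gamma> assms(1) by (simp add: field_simps)
    qed
    have "norm (H powr (\<beta> - \<alpha>) / \<Gamma> * S n - H powr (\<beta> - \<alpha>) / \<Gamma> * A n) = H powr (\<beta> - \<alpha>) / \<Gamma> * \<bar>S n - A n\<bar>"
      unfolding right_diff_distrib[symmetric] using \<Gamma> by (simp add: abs_mult)
    also have "\<dots> \<le> H powr (\<beta> - \<alpha>) / \<Gamma> * (C * real n powr (\<beta> - 2))"
      using \<Gamma> by (intro mult_left_mono C n) auto
    also have "\<dots> = (C * t powr (\<beta> - 2) / \<Gamma>) * norm (H powr (2 - \<alpha>))"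
    proof -
      \<comment> \<open>The surplus H^(\<beta> - 2) joins n^(\<beta> - 2) to give the constant
        t^(\<beta> - 2).\<close>
      have "H powr (\<beta> - \<alpha>) = H powr (\<beta> - 2) * H powr (2 - \<alpha>)" by (simp flip: powr_add)
      then show ?thesis unfolding tp by simp
    qed
    finally show ?thesis
      unfolding H_def[symmetric] main c z1 z2 A_def by (simp add: algebra_simps)
  qed
  then show ?thesis
    unfolding z1_def z2_def \<Gamma>_def
    \<comment> \<open>\<open>h\<close> is prescribed only from n = 2 on.\<close>
    by (intro bigoI eventually_sequentiallyI[of 2])
qed

end
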